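(* Let $n\ge1$, let $U\subset\mathrm{GL}_n(\mathbf{C})$ be the standard unipotent subgroup of upper-triangular matrices with all diagonal entries equal to $1$, acting by conjugation on the nilpotent cone $\mathcal{N}$ of nilpotent complex $n\times n$ matrices. Then the $U$-invariant ring $K[\mathcal{N}]^U$ is spanned (as a $K$-vector space) by the $U$-invariant functions $f^{\mathcal{P}}$, where $\mathcal{P}$ runs through all data $\mathcal{P}=((a_i)_i,(a'_j)_j,(\mathcal{P}_{i,j})_{i,j})$ as defined in the context.
   Context: $K=\mathbf{C}$. $K[\mathcal{N}]^U$ is the ring of regular functions $f$ on $\mathcal{N}$ with $f(gNg^{-1})=f(N)$ for all $g\in U$, $N\in\mathcal{N}$. For $a,b\in\{0,\dots,n\}$ and an $n\times n$ matrix $N$, $N_{(a,b)}$ denotes the $a\times b$ submatrix formed by the last $a$ rows and the first $b$ columns of $N$. A datum $\mathcal{P}=((a_i)_i,(a'_j)_j,(\mathcal{P}_{i,j})_{i,j})$ consists of positive integers $s,t$, integers $a_1,\dots,a_s,a'_1,\dots,a'_t\in\{1,\dots,n\}$ with $a_1+\dots+a_s=a'_1+\dots+a'_t=:r$, and polynomials $\mathcal{P}_{i,j}(x)\in K[x]$ for $1\le i\le s$, $1\le j\le t$. For $N\in\mathcal{N}$ let $N^{\mathcal{P}}$ be the $r\times r$ block matrix whose $(i,j)$ block is the $a_i\times a'_j$ matrix $\mathcal{P}_{i,j}(N)_{(a_i,a'_j)}$. Define $f^{\mathcal{P}}\colon\mathcal{N}\to K$, $f^{\mathcal{P}}(N)=\det(N^{\mathcal{P}})$.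 Each $f^{\mathcal{P}}$ is a $U$-invariant regular function on $\mathcal{N}$ (it is a semi-invariant for the group of invertible upper-triangular matrices). *)

theory Defs
  imports
    "HOL-Library.Function_Algebras"
    "HOL-Computational_Algebra.Polynomial"
    "Jordan_Normal_Form.Determinant"
    "Jordan_Normal_Form.DL_Submatrix"
begin

definition nilpotent_cone :: "nat \<Rightarrow> complex mat set" where
  "nilpotent_cone n = {N \<in> carrier_mat n n. \<exists>k. N ^\<^sub>m k = 0\<^sub>m n n}"

definition unipotent_group :: "nat \<Rightarrow> complex mat set" where
  "unipotent_group n =
     {g \<in> carrier_mat n n. upper_triangular g \<and> (\<forall>i<n. g $$ (i,i) = 1)}"

inductive_set polynomial_functions :: "nat \<Rightarrow> (complex mat \<Rightarrow> complex) set" for n :: nat where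
  const: "(\<lambda>_. c) \<in> polynomial_functions n"
| entry: "i < n \<Longrightarrow> j < n \<Longrightarrow> (\<lambda>N. N $$ (i,j)) \<in> polynomial_functions n"
| add: "p \<in> polynomial_functions n \<Longrightarrow> q \<in> polynomial_functions n \<Longrightarrow>
    (\<lambda>N. p N + q N) \<in> polynomial_functions n"
| mult: "p \<in> polynomial_functions n \<Longrightarrow> q \<in> polynomial_functions n \<Longrightarrow>
    (\<lambda>N. p N * q N) \<in> polynomial_functions n"

text \<open>
  The nilpotent cone is Zariski closed in the affine space of all matrices, so its regular
  functions are the restrictions of polynomial functions. A function on the cone is represented
  by its extension by zero to the whole type of matrices.
\<close>

definition regular_functions :: "nat \<Rightarrow> (complex mat \<Rightarrow> complex) set" where
  "regular_functions n =
     {f. (\<exists>p \<in> polynomial_functions n. \<forall>N \<in> nilpotent_cone n. f N = p N) \<and>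
         (\<forall>N. N \<notin> nilpotent_cone n \<longrightarrow> f N = 0)}"

text \<open>In the invariance condition, \<open>h\<close> is the inverse of \<open>g\<close>.\<close>

definition U_invariants :: "nat \<Rightarrow> (complex mat \<Rightarrow> complex) set" where
  "U_invariants n =
     {f \<in> regular_functions n.
        \<forall>g \<in> unipotent_group n. \<forall>h \<in> carrier_mat n n. inverts_mat g h \<and> inverts_mat h g \<longrightarrow>
          (\<forall>N \<in> nilpotent_cone n. f (g * N * h) = f N)}"

interpretation fun_space: vector_space
  "\<lambda>(c::complex) (f :: complex mat \<Rightarrow> complex) N. c * f N"
  by unfold_locales (auto simp: fun_eq_iff algebra_simps)

definition mat_poly :: "complex poly \<Rightarrow> complex mat \<Rightarrow> complex mat" where
  "mat_poly p N =
     mat (dim_row N) (dim_row N) (\<lambda>(i,j). \<Sum>k\<le>degree p. coeff p k * (N ^\<^sub>m k) $$ (i,j))"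

definition corner :: "complex mat \<Rightarrow> nat \<Rightarrow> nat \<Rightarrow> complex mat" where
  "corner N a b = submatrix N {dim_row N - a..<dim_row N} {..<b}"

lemma pick_interval:
  assumes "i < m"
  shows "pick {c..<c + m} i = c + i"
proof -
  have "{x \<in> {c..<c + m}. x < c + i} = {c..<c + i}" using assms by auto
  then have "card {x \<in> {c..<c + m}. x < c + i} = i" by simp
  moreover have "c + i \<in> {c..<c + m}" using assms by simp
  ultimately show ?thesis using pick_card_in_set by metis
qed

lemma corner_alt:
  assumes "a \<le> dim_row N" "b \<le> dim_col N"
  shows "corner N a b = mat a b (\<lambda>(i,j). N $$ (dim_row N - a + i, j))"
proof -
  obtain c where c: "dim_row N = c + a" using assms(1) by (metis add.commute le_Suc_ex)
  have I: "{i. i < c + a \<and> i \<in> {c..<c + a}} = {c..<c + a}"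
    and J: "{j. j < dim_col N \<and> j \<in> {..<b}} = {..<b}"
    using assms(2) by auto
  have pJ: "pick {..<b} j = j" if "j < b" for j
    using pick_interval[of j b 0] that by (simp add: lessThan_atLeast0)
  have d: "c + a - a = c" by simp
  show ?thesis unfolding corner_def submatrix_def c d I J
    by (rule eq_matI) (simp_all add: pick_interval pJ)
qed

text \<open>
  For a list of block sizes, \<open>block_pos\<close> sends a global index to the pair of the number of its
  block and its position within that block (both counted from 0).
\<close>

fun block_pos :: "nat list \<Rightarrow> nat \<Rightarrow> nat \<times> nat" where
  "block_pos [] p = (0, p)"
| "block_pos (a # as) p =
     (if p < a then (0, p) else (case block_pos as (p - a) of (i, k) \<Rightarrow> (Suc i, k)))"

definition block_mat :: "nat list \<Rightarrow> nat list \<Rightarrow> (nat \<Rightarrow> nat \<Rightarrow> complex mat) \<Rightarrow> complex mat" where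
  "block_mat as bs B = mat (sum_list as) (sum_list bs)
     (\<lambda>(p,q). case (block_pos as p, block_pos bs q) of ((i,k), (j,l)) \<Rightarrow> B i j $$ (k,l))"

lemma block_pos_eq:
  "i < length as \<Longrightarrow> k < as ! i \<Longrightarrow> block_pos as (sum_list (take i as) + k) = (i, k)"
proof (induction as arbitrary: i)
  case (Cons a as)
  then show ?case by (cases i) auto
qed simp

lemma block_index_less:
  "i < length as \<Longrightarrow> k < as ! i \<Longrightarrow> sum_list (take i as) + k < sum_list (as :: nat list)"
proof (induction as arbitrary: i)
  case (Cons a as)
  then show ?case by (cases i) auto
qed simp

lemma block_mat_index:
  assumes "i < length as" "k < as ! i" "j < length bs" "l < bs ! j"
  shows "block_mat as bs B $$ (sum_list (take i as) + k, sum_list (take j bs) + l) = B i j $$ (k,l)"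
  using assms by (simp add: block_mat_def block_pos_eq block_index_less)

text \<open>
  A datum consists of the list \<open>as\<close> of row sizes (with \<open>s = length as\<close>), the list \<open>bs\<close> of column
  sizes (with \<open>t = length bs\<close>) and a family \<open>P\<close> of polynomials indexed from 0; only the values
  \<open>P i j\<close> with \<open>i < s\<close> and \<open>j < t\<close> matter.
\<close>

definition is_datum :: "nat \<Rightarrow> nat list \<Rightarrow> nat list \<Rightarrow> (nat \<Rightarrow> nat \<Rightarrow> complex poly) \<Rightarrow> bool" where
  "is_datum n as bs P \<longleftrightarrow>
     as \<noteq> [] \<and> bs \<noteq> [] \<and> set as \<subseteq> {1..n} \<and> set bs \<subseteq> {1..n} \<and> sum_list as = sum_list bs"

definition datum_mat ::
  "nat list \<Rightarrow> nat list \<Rightarrow> (nat \<Rightarrow> nat \<Rightarrow> complex poly) \<Rightarrow> complex mat \<Rightarrow> complex mat" where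
  "datum_mat as bs P N =
     block_mat as bs (\<lambda>i j. corner (mat_poly (P i j) N) (as ! i) (bs ! j))"

definition datum_fun ::
  "nat \<Rightarrow> nat list \<Rightarrow> nat list \<Rightarrow> (nat \<Rightarrow> nat \<Rightarrow> complex poly) \<Rightarrow> complex mat \<Rightarrow> complex" where
  "datum_fun n as bs P N =
     (if N \<in> nilpotent_cone n then det (datum_mat as bs P N) else 0)"

end

theory Submission
  imports Defs "Jordan_Normal_Form.Char_Poly"
begin

text \<open>
  For a \<open>U\<close>-invariant polynomial function \<open>f\<close> on the cone and large \<open>K\<close>, the function
  \<open>F(N,g) = det(g)^K f(g\<^sup>-\<^sup>1 N g)\<close> is, by Cramer's rule, a combination of products of \<open>K\<close> brackets, i.e.
  determinants of \<open>n\<close> columns, each of which is a column of \<open>g\<close> or of \<open>N g\<close>. For fixed \<open>N\<close> it is the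
  polynomial attached to a tensor in \<open>d = K n\<close> column positions, and invariance under \<open>g \<mapsto> g u\<close> makes
  the symmetrization of this tensor a highest weight tensor. Such a tensor is recovered, up to a
  positive factor, by antisymmetrizing along the columns of a tableau; the columns are split off one
  at a time. Evaluated at \<open>g = 1\<close>, an antisymmetrized product of brackets is a mixed discriminant of
  matrices with \<open>K\<close> row blocks of height \<open>n\<close> and one column block per tableau column, and by
  inclusion-exclusion a mixed discriminant is an alternating sum of determinants of datum matrices.
\<close>

section \<open>Column alternation of highest weight tensors\<close>

text \<open>The function \<open>f\<close> is invariant on the cone only, and no extension to an
  invariant polynomial on all matrices is assumed. Hence \<open>N\<close> stays a parameter
  throughout and all the work happens in the variable \<open>g\<close>. The tableau and the positive
  factor must be the same for all \<open>N\<close>, which is why tensor families carry a parameter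
  \<open>s\<close>. Antisymmetrizing loses nothing because each signed column permutation multiplies
  the relevant coefficients by a positive scalar, so that the sum cannot cancel. Coefficients at
  pairs of equal words \<open>(\<rho>, \<rho>)\<close> suffice: at \<open>g = 1\<close> all others
  drop out, and \<open>\<rho>\<close> is constant along its own rows. The passage to datum functions
  rests on the blocks being polynomials in \<open>N\<close>: adding the contributions of several
  positions to a block only adds monomials to its polynomial. So determinants of subset sums are
  datum functions, while a single term of the mixed discriminant in general does not have that
  shape. A tableau column carries the letters \<open>0, 1, ..., b - 1\<close>, and this produces the
  first \<open>b\<close> columns of the powers of \<open>N\<close>.\<close>

definition row_const :: "nat set \<Rightarrow> (nat \<Rightarrow> nat) \<Rightarrow> (nat \<Rightarrow> nat) \<Rightarrow> bool" where
  "row_const D \<rho> v \<longleftrightarrow> (\<forall>a\<in>D. \<forall>b\<in>D. \<rho> a = \<rho> b \<longrightarrow> v a = v b)"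

text \<open>
  \<open>\<Phi> v\<close> is the coefficient of a symmetrized tensor at the pair of words \<open>(\<rho>, v)\<close> in the positions \<open>D\<close>.
  The sum condition says that the raising operator taking the letter \<open>\<rho> b\<close> to \<open>i\<close> kills the tensor;
  in the language of tableaux it is a Garnir relation between the rows \<open>i\<close> and \<open>\<rho> b\<close>.
\<close>

definition highest_weight ::
  "nat set \<Rightarrow> (nat \<Rightarrow> nat) \<Rightarrow> ((nat \<Rightarrow> nat) \<Rightarrow> 's \<Rightarrow> complex) \<Rightarrow> bool" where
  "highest_weight D \<rho> \<Phi> \<longleftrightarrow>
     (\<forall>a\<in>D. \<forall>b\<in>D. \<rho> a = \<rho> b \<longrightarrow> (\<forall>v s. \<Phi> (v \<circ> transpose a b) s = \<Phi> v s)) \<and>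
     (\<forall>b\<in>D. \<forall>i<\<rho> b. \<forall>v s.
        \<Phi> v s + (\<Sum>a | a \<in> D \<and> \<rho> a = i. \<Phi> (v \<circ> transpose a b) s) = 0)"

lemma highest_weight_row:
  "highest_weight D \<rho> \<Phi> \<Longrightarrow> a \<in> D \<Longrightarrow> b \<in> D \<Longrightarrow> \<rho> a = \<rho> b \<Longrightarrow>
     \<Phi> (v \<circ> transpose a b) s = \<Phi> v s"
  unfolding highest_weight_def by blast

lemma highest_weight_raise:
  "highest_weight D \<rho> \<Phi> \<Longrightarrow> b \<in> D \<Longrightarrow> i < \<rho> b \<Longrightarrow>
     \<Phi> v s + (\<Sum>a | a \<in> D \<and> \<rho> a = i. \<Phi> (v \<circ> transpose a b) s) = 0"
  unfolding highest_weight_def by blast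

definition alternate ::
  "nat set \<Rightarrow> ((nat \<Rightarrow> nat) \<Rightarrow> 's \<Rightarrow> complex) \<Rightarrow> (nat \<Rightarrow> nat) \<Rightarrow> 's \<Rightarrow> complex" where
  "alternate Q \<Phi> v s = (\<Sum>\<sigma> | \<sigma> permutes Q. of_int (sign \<sigma>) * \<Phi> (v \<circ> \<sigma>) s)"

lemma sign_comp_transpose:
  assumes "\<sigma> permutes Q" "finite Q" "a \<noteq> b"
  shows "sign (\<sigma> \<circ> transpose a b) = - sign \<sigma>"
proof -
  have "permutation \<sigma>" using assms permutation_permutes by blast
  then show ?thesis
    by (simp add: sign_compose permutation_swap_id sign_swap_id assms)
qed

text \<open>
  If \<open>b\<close> is the moved position with the largest letter, then the relation at \<open>b\<close> and \<open>\<rho> (\<sigma> b)\<close> collapses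
  on row-constant words: all swaps but the one with \<open>\<sigma> b\<close> fix the word. This expresses \<open>\<Phi> (v \<circ> \<sigma>)\<close> by a
  permutation with fewer moved positions.
\<close>

lemma column_permutation_scales:
  assumes fin: "finite D" and hw: "highest_weight D \<rho> \<Phi>"
    and Q: "Q \<subseteq> D" "inj_on \<rho> Q"
    and \<sigma>: "\<sigma> permutes Q"
  shows "\<exists>\<kappa>>0. \<forall>v s. row_const D \<rho> v \<longrightarrow>
           of_int (sign \<sigma>) * \<Phi> (v \<circ> \<sigma>) s = complex_of_real \<kappa> * \<Phi> v s"
  using \<sigma>
proof (induction "card {x. \<sigma> x \<noteq> x}" arbitrary: \<sigma> rule: less_induct)
  case less
  note \<sigma> = less.prems
  let ?M = "{x. \<sigma> x \<noteq> x}"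
  have finQ: "finite Q" using Q fin finite_subset by blast
  have MQ: "?M \<subseteq> Q" using \<sigma> by (auto simp: permutes_def)
  have finM: "finite ?M" using MQ finQ finite_subset by blast
  show ?case
  proof (cases "?M = {}")
    case True
    then have "\<sigma> = id" by auto
    then show ?thesis by (intro exI[of _ 1]) simp
  next
    case False
    define l where "l = Max (\<rho> ` ?M)"
    have "l \<in> \<rho> ` ?M" unfolding l_def using finM False by (intro Max_in) auto
    then obtain b where b: "b \<in> ?M" "\<rho> b = l" by auto
    define p where "p = \<sigma> b"
    have inj: "inj \<sigma>" using \<sigma> permutes_inj by blast
    have pb: "p \<noteq> b" using b p_def by auto
    have pM: "p \<in> ?M" using inj b pb unfolding p_def by (auto dest: injD)
    have pQ: "p \<in> Q" "b \<in> Q" using pM b MQ by auto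
    have "\<rho> p \<le> l" unfolding l_def using finM pM by (intro Max_ge) auto
    moreover have "\<rho> p \<noteq> l" using Q(2) pQ pb b(2) by (auto dest: inj_onD)
    ultimately have lt: "\<rho> p < \<rho> b" using b by auto
    define \<tau> where "\<tau> = \<sigma> \<circ> transpose p b"
    have \<tau>: "\<tau> permutes Q" unfolding \<tau>_def
      using \<sigma> pQ by (intro permutes_compose permutes_swap_id) auto
    have \<tau>p: "\<tau> p = p" unfolding \<tau>_def using p_def by simp
    have "{x. \<tau> x \<noteq> x} \<subseteq> ?M - {p}"
      using b \<tau>p unfolding \<tau>_def by (auto simp: transpose_def split: if_splits)
    then have "card {x. \<tau> x \<noteq> x} < card ?M"
      using finM pM by (metis (no_types, lifting) card_mono card_Diff1_less finite_Diff le_less_trans)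
    from less.hyps[OF this \<tau>] obtain \<kappa> where \<kappa>: "\<kappa> > 0"
      "\<And>v s. row_const D \<rho> v \<Longrightarrow> of_int (sign \<tau>) * \<Phi> (v \<circ> \<tau>) s = complex_of_real \<kappa> * \<Phi> v s"
      by blast
    let ?R = "{a \<in> D. \<rho> a = \<rho> p}"
    have pR: "p \<in> ?R" using pQ Q by auto
    have finR: "finite ?R" using fin by auto
    define m where "m = card ?R"
    have m: "m > 0" unfolding m_def using pR finR by (auto simp: card_gt_0_iff)
    have sgn: "sign \<tau> = - sign \<sigma>" unfolding \<tau>_def
      by (rule sign_comp_transpose[OF \<sigma> finQ pb])
    \<comment> \<open>The relation gives \<open>m * \<Phi> (v \<circ> \<sigma>) s = - \<Phi> (v
      \<circ> \<tau>) s\<close>. The minus sign is absorbed by the opposite sign of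
      \<open>\<tau>\<close>, so the factor stays positive.\<close>
    have "of_int (sign \<sigma>) * \<Phi> (v \<circ> \<sigma>) s = complex_of_real (\<kappa> / m) * \<Phi> v s"
      if v: "row_const D \<rho> v" for v s
    proof -
      have rel: "\<Phi> (v \<circ> \<sigma>) s + (\<Sum>a\<in>?R. \<Phi> (v \<circ> \<sigma> \<circ> transpose a b) s) = 0"
        using highest_weight_raise[OF hw _ lt, of "v \<circ> \<sigma>" s] pQ Q by auto
      \<comment> \<open>The row of \<open>p\<close> meets \<open>Q\<close> only in \<open>p\<close>,
        so \<open>\<sigma>\<close> fixes \<open>a\<close>, and \<open>v\<close> takes the same value
        at \<open>a\<close> and at \<open>p = \<sigma> b\<close>.\<close>
      have eq: "v \<circ> \<sigma> \<circ> transpose a b = v \<circ> \<sigma>" if a: "a \<in> ?R - {p}" for a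
      proof -
        have "a \<notin> Q" using a Q(2) pQ by (auto dest: inj_onD)
        then have "\<sigma> a = a" using \<sigma> by (auto simp: permutes_def)
        moreover have "v a = v p" using v a pR unfolding row_const_def by blast
        ultimately show ?thesis by (auto simp: fun_eq_iff transpose_def p_def)
      qed
      have cancel: "M * x = - y" if "z = y + (M - 1) * x" "x + z = 0" for M x y z :: complex
        using that by (simp add: algebra_simps add_eq_0_iff2)
      have "(\<Sum>a\<in>?R. \<Phi> (v \<circ> \<sigma> \<circ> transpose a b) s)
          = \<Phi> (v \<circ> \<tau>) s + (\<Sum>a\<in>?R - {p}. \<Phi> (v \<circ> \<sigma> \<circ> transpose a b) s)"
        by (subst sum.remove[OF finR pR]) (simp add: \<tau>_def comp_assoc)
      also have "(\<Sum>a\<in>?R - {p}. \<Phi> (v \<circ> \<sigma> \<circ> transpose a b) s) = (\<Sum>a\<in>?R - {p}. \<Phi> (v \<circ> \<sigma>) s)"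
        by (rule sum.cong) (use eq in auto)
      also have "\<dots> = (of_nat m - 1) * \<Phi> (v \<circ> \<sigma>) s"
        using pR finR m by (simp add: m_def of_nat_diff)
      finally have "of_nat m * \<Phi> (v \<circ> \<sigma>) s = - \<Phi> (v \<circ> \<tau>) s"
        by (rule cancel[OF _ rel])
      then have "of_nat m * (of_int (sign \<sigma>) * \<Phi> (v \<circ> \<sigma>) s) = of_int (sign \<tau>) * \<Phi> (v \<circ> \<tau>) s"
        unfolding sgn by (simp add: mult.left_commute[of "of_nat m"])
      also have "\<dots> = complex_of_real \<kappa> * \<Phi> v s" by (rule \<kappa>(2)[OF v])
      finally show ?thesis using m by (simp add: field_simps)
    qed
    then show ?thesis using \<kappa>(1) m by (intro exI[of _ "\<kappa> / m"]) auto
  qed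
qed

text \<open>The signed terms are all positive multiples of the same value \<open>\<Phi> v s\<close>,
  so they cannot cancel. The factor depends on neither \<open>v\<close> nor
  \<open>s\<close>.\<close>

lemma alternate_scales:
  assumes "finite D" "highest_weight D \<rho> \<Phi>" "Q \<subseteq> D" "inj_on \<rho> Q"
  shows "\<exists>\<kappa>>0. \<forall>v s. row_const D \<rho> v \<longrightarrow> alternate Q \<Phi> v s = complex_of_real \<kappa> * \<Phi> v s"
proof -
  have finQ: "finite Q" using assms finite_subset by blast
  let ?P = "{\<sigma>. \<sigma> permutes Q}"
  obtain \<kappa> where \<kappa>: "\<And>\<sigma>. \<sigma> \<in> ?P \<Longrightarrow> \<kappa> \<sigma> > 0"
    "\<And>\<sigma> v s. \<sigma> \<in> ?P \<Longrightarrow> row_const D \<rho> v \<Longrightarrow>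
       of_int (sign \<sigma>) * \<Phi> (v \<circ> \<sigma>) s = complex_of_real (\<kappa> \<sigma>) * \<Phi> v s"
    using column_permutation_scales[OF assms] by (auto intro: that dest!: bchoice[of ?P] simp: Ball_def) metis
  have "?P \<noteq> {}" using permutes_id[of Q] by blast
  then have "sum \<kappa> ?P > 0"
    by (rule sum_pos[OF finite_permutations[OF finQ] _ \<kappa>(1)])
  then show ?thesis
    by (intro exI[of _ "sum \<kappa> ?P"])
       (auto simp: alternate_def sum_distrib_right \<kappa>(2) intro!: sum.cong)
qed

text \<open>Composing with the transposition flips the sign and preserves \<open>\<Psi>\<close>, so
  the sum equals its own negative.\<close>

lemma sum_sign_swap_zero:
  fixes \<Psi> :: "(nat \<Rightarrow> nat) \<Rightarrow> complex"
  assumes Q: "finite Q" "p \<in> Q" "q \<in> Q" "p \<noteq> q"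
    and sym: "\<And>\<sigma>. \<sigma> permutes Q \<Longrightarrow> \<Psi> (\<sigma> \<circ> transpose p q) = \<Psi> \<sigma>"
  shows "(\<Sum>\<sigma> | \<sigma> permutes Q. of_int (sign \<sigma>) * \<Psi> \<sigma>) = 0"
proof -
  let ?P = "{\<sigma>. \<sigma> permutes Q}"
  let ?t = "transpose p q"
  have t: "?t permutes Q" using Q by (intro permutes_swap_id)
  have "(\<Sum>\<sigma>\<in>?P. of_int (sign \<sigma>) * \<Psi> \<sigma>) = (\<Sum>\<sigma>\<in>?P. of_int (sign (\<sigma> \<circ> ?t)) * \<Psi> (\<sigma> \<circ> ?t))"
    by (rule sum.reindex_bij_witness[of _ "\<lambda>\<sigma>. \<sigma> \<circ> ?t" "\<lambda>\<sigma>. \<sigma> \<circ> ?t"])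
       (use t in \<open>auto simp: comp_assoc intro: permutes_compose\<close>)
  also have "\<dots> = - (\<Sum>\<sigma>\<in>?P. of_int (sign \<sigma>) * \<Psi> \<sigma>)"
    unfolding sum_negf[symmetric]
    by (rule sum.cong) (auto simp: sym sign_comp_transpose[OF _ Q(1,4)])
  finally show ?thesis by simp
qed

lemma comp_transpose_disjoint:
  assumes "\<sigma> permutes Q" "a \<notin> Q" "b \<notin> Q"
  shows "transpose a b \<circ> \<sigma> = \<sigma> \<circ> transpose a b"
proof
  fix x
  show "(transpose a b \<circ> \<sigma>) x = (\<sigma> \<circ> transpose a b) x"
    using assms permutes_in_image[OF assms(1), of x]
    by (auto simp: transpose_def permutes_def)
qed

text \<open>Swaps outside \<open>Q\<close> commute with permutations of \<open>Q\<close>, so row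
  symmetry is inherited. A raising relation on \<open>D - Q\<close> misses one term of the relation
  on \<open>D\<close>, that of the position \<open>p\<close> of \<open>Q\<close> in row
  \<open>i\<close>. Since \<open>Q\<close> meets every row, it also has a position \<open>q\<close>
  in the row of \<open>b\<close>; antisymmetry in \<open>p\<close> and \<open>q\<close> against
  symmetry in \<open>b\<close> and \<open>q\<close> kills the missing term.\<close>

lemma highest_weight_alternate:
  assumes fin: "finite D" and hw: "highest_weight D \<rho> \<Phi>"
    and Q: "Q \<subseteq> D" "inj_on \<rho> Q" "\<rho> ` Q = \<rho> ` D"
    and closed: "\<And>b i. b \<in> D \<Longrightarrow> i < \<rho> b \<Longrightarrow> i \<in> \<rho> ` D"
  shows "highest_weight (D - Q) \<rho> (alternate Q \<Phi>)"
  unfolding highest_weight_def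
proof (intro conjI ballI allI impI)
  fix a b v s assume ab: "a \<in> D - Q" "b \<in> D - Q" "\<rho> a = \<rho> b"
  have "\<Phi> (v \<circ> transpose a b \<circ> \<sigma>) s = \<Phi> (v \<circ> \<sigma>) s" if "\<sigma> permutes Q" for \<sigma>
  proof -
    have "v \<circ> transpose a b \<circ> \<sigma> = v \<circ> \<sigma> \<circ> transpose a b"
      using comp_transpose_disjoint[OF that, of a b] ab by (simp add: comp_assoc)
    then show ?thesis using highest_weight_row[OF hw, of a b] ab by simp
  qed
  then show "alternate Q \<Phi> (v \<circ> transpose a b) s = alternate Q \<Phi> v s"
    unfolding alternate_def by (intro sum.cong) auto
next
  have finQ: "finite Q" using Q fin finite_subset by blast
  fix b i v s assume b: "b \<in> D - Q" and i: "i < \<rho> b"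
  have "i \<in> \<rho> ` Q" using closed[of b i] b i Q by auto
  then obtain p where p: "p \<in> Q" "\<rho> p = i" by auto
  have "\<rho> b \<in> \<rho> ` Q" using b Q by auto
  then obtain q where q: "q \<in> Q" "\<rho> q = \<rho> b" by auto
  have pq: "p \<noteq> q" "b \<noteq> p" "b \<noteq> q" using p q i b by auto
  let ?P = "{\<sigma>. \<sigma> permutes Q}"
  let ?R = "{a. a \<in> D - Q \<and> \<rho> a = i}"
  have R: "{a. a \<in> D \<and> \<rho> a = i} = insert p ?R" "p \<notin> ?R" "finite ?R"
    using p Q fin by (auto dest: inj_onD)
  have one: "\<Phi> (v \<circ> \<sigma>) s + (\<Sum>a\<in>?R. \<Phi> (v \<circ> transpose a b \<circ> \<sigma>) s)
      = - \<Phi> (v \<circ> \<sigma> \<circ> transpose p b) s" if \<sigma>: "\<sigma> \<in> ?P" for \<sigma>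
  proof -
    have "\<Phi> (v \<circ> \<sigma>) s + (\<Sum>a | a \<in> D \<and> \<rho> a = i. \<Phi> (v \<circ> \<sigma> \<circ> transpose a b) s) = 0"
      using highest_weight_raise[OF hw _ i, of "v \<circ> \<sigma>" s] b by simp
    moreover have "(\<Sum>a\<in>?R. \<Phi> (v \<circ> transpose a b \<circ> \<sigma>) s)
        = (\<Sum>a\<in>?R. \<Phi> (v \<circ> \<sigma> \<circ> transpose a b) s)"
    proof (rule sum.cong[OF refl])
      fix a assume "a \<in> ?R"
      then show "\<Phi> (v \<circ> transpose a b \<circ> \<sigma>) s = \<Phi> (v \<circ> \<sigma> \<circ> transpose a b) s"
        using comp_transpose_disjoint[of \<sigma> Q a b] \<sigma> b by (simp add: comp_assoc)
    qed
    moreover have "x + y = - u" if "x + (u + z) = 0" "y = z" for x y z u :: complex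
      using that by (simp add: eq_neg_iff_add_eq_0 ac_simps)
    ultimately show ?thesis unfolding R(1) sum.insert[OF R(3,2)] by blast
  qed
  have "alternate Q \<Phi> v s + (\<Sum>a\<in>?R. alternate Q \<Phi> (v \<circ> transpose a b) s)
     = (\<Sum>\<sigma>\<in>?P. of_int (sign \<sigma>) *
          (\<Phi> (v \<circ> \<sigma>) s + (\<Sum>a\<in>?R. \<Phi> (v \<circ> transpose a b \<circ> \<sigma>) s)))"
    unfolding alternate_def
    by (subst sum.swap) (simp add: sum.distrib distrib_left sum_distrib_left)
  also have "\<dots> = - (\<Sum>\<sigma>\<in>?P. of_int (sign \<sigma>) * \<Phi> (v \<circ> \<sigma> \<circ> transpose p b) s)"
    unfolding sum_negf[symmetric] by (rule sum.cong) (use one in auto)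
  also have "(\<Sum>\<sigma>\<in>?P. of_int (sign \<sigma>) * \<Phi> (v \<circ> \<sigma> \<circ> transpose p b) s) = 0"
  proof (rule sum_sign_swap_zero[OF finQ p(1) q(1) pq(1)])
    fix \<sigma> assume "\<sigma> permutes Q"
    \<comment> \<open>Conjugation by the swap of \<open>p\<close> and \<open>b\<close> turns the
      swap of \<open>p\<close> and \<open>q\<close> into that of \<open>b\<close> and
      \<open>q\<close>, which lie in the same row.\<close>
    have "\<sigma> \<circ> transpose p q \<circ> transpose p b = \<sigma> \<circ> transpose p b \<circ> transpose b q"
      using pq by (auto simp: fun_eq_iff transpose_def)
    then have "v \<circ> (\<sigma> \<circ> transpose p q) \<circ> transpose p b = v \<circ> \<sigma> \<circ> transpose p b \<circ> transpose b q"
      by (simp add: comp_assoc)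
    moreover have "\<Phi> (w \<circ> transpose b q) s = \<Phi> w s" for w
      using highest_weight_row[OF hw, of b q] b q Q by auto
    ultimately show "\<Phi> (v \<circ> (\<sigma> \<circ> transpose p q) \<circ> transpose p b) s = \<Phi> (v \<circ> \<sigma> \<circ> transpose p b) s"
      by simp
  qed
  finally show "alternate Q \<Phi> v s + (\<Sum>a\<in>?R. alternate Q \<Phi> (v \<circ> transpose a b) s) = 0"
    by (simp only: minus_zero)
qed

text \<open>The list \<open>pss\<close> consists of the columns of a tableau, each listed from the top.\<close>

definition column_group :: "nat list list \<Rightarrow> (nat \<Rightarrow> nat) set" where
  "column_group pss =
     {\<gamma>. \<gamma> permutes set (concat pss) \<and> (\<forall>ps\<in>set pss. \<forall>x\<in>set ps. \<gamma> x \<in> set ps)}"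

lemma column_group_Nil: "column_group [] = {id}"
  by (auto simp: column_group_def)

lemma column_group_permutes: "\<gamma> \<in> column_group pss \<Longrightarrow> \<gamma> permutes set (concat pss)"
  by (simp add: column_group_def)

text \<open>A permutation preserving \<open>ps\<close> and the other columns splits uniquely into
  its part on \<open>ps\<close> and its part elsewhere, each extended by the identity.\<close>

lemma sum_column_group_Cons:
  fixes f :: "(nat \<Rightarrow> nat) \<Rightarrow> complex"
  assumes disj: "set ps \<inter> set (concat pss) = {}"
  shows "(\<Sum>\<gamma>\<in>column_group (ps # pss). f \<gamma>)
       = (\<Sum>\<gamma>\<in>column_group pss. \<Sum>\<sigma> | \<sigma> permutes set ps. f (\<gamma> \<circ> \<sigma>))"
proof -
  let ?Q = "set ps" and ?E = "set (concat pss)"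
  let ?part = "\<lambda>S \<gamma> x. if x \<in> S then \<gamma> x else x"
  have bij: "?part S \<gamma> permutes S" if "\<gamma> permutes T" "S \<subseteq> T" "finite S" "\<And>x. x \<in> S \<Longrightarrow> \<gamma> x \<in> S"
    for S T :: "nat set" and \<gamma>
  proof (rule bij_imp_permutes)
    have "inj_on (?part S \<gamma>) S"
      using permutes_inj_on[OF that(1), of S] by (auto simp: inj_on_def)
    then show "bij_betw (?part S \<gamma>) S S"
      using endo_inj_surj[OF that(3), of "?part S \<gamma>"] that(4) by (simp add: bij_betw_def image_subset_iff)
  qed simp
  have col: "\<gamma> x \<in> ?E" if "\<gamma> \<in> column_group (ps # pss)" "x \<in> ?E" for \<gamma> x
    using that by (auto simp: column_group_def)
  have Qin: "\<gamma> x \<in> ?Q" if "\<gamma> \<in> column_group (ps # pss)" "x \<in> ?Q" for \<gamma> x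
    using that by (auto simp: column_group_def)
  have perm: "\<gamma> permutes (?Q \<union> ?E)" if "\<gamma> \<in> column_group (ps # pss)" for \<gamma>
    using that by (auto simp: column_group_def)
  have "(\<Sum>\<gamma>\<in>column_group (ps # pss). f \<gamma>)
      = (\<Sum>(\<gamma>,\<sigma>)\<in>column_group pss \<times> {\<sigma>. \<sigma> permutes ?Q}. f (\<gamma> \<circ> \<sigma>))"
  proof (rule sum.reindex_bij_witness[of _ "\<lambda>(\<gamma>,\<sigma>). \<gamma> \<circ> \<sigma>"
        "\<lambda>\<gamma>. (?part ?E \<gamma>, ?part ?Q \<gamma>)"], goal_cases)
    case (1 \<gamma>)
    have "(?part ?E \<gamma> \<circ> ?part ?Q \<gamma>) x = \<gamma> x" for x
      using perm[OF 1] Qin[OF 1, of x] disj by (auto simp: permutes_def)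
    then show ?case by auto
  next
    case (2 \<gamma>)
    have "?part ?Q \<gamma> permutes ?Q" using Qin[OF 2] by (intro bij[OF perm[OF 2]]) auto
    moreover have "?part ?E \<gamma> permutes ?E" using col[OF 2] by (intro bij[OF perm[OF 2]]) auto
    moreover have "?part ?E \<gamma> x \<in> set qs" if "qs \<in> set pss" "x \<in> set qs" for qs x
      using 2 that by (auto simp: column_group_def)
    ultimately show ?case by (auto simp: column_group_def)
  next
    case (3 p)
    obtain \<gamma> \<sigma> where p: "p = (\<gamma>,\<sigma>)" "\<gamma> \<in> column_group pss" "\<sigma> permutes ?Q" using 3 by auto
    have \<gamma>: "\<gamma> permutes ?E" using p by (simp add: column_group_def)
    have "?part ?E (\<gamma> \<circ> \<sigma>) = \<gamma>"
    proof
      fix x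
      have "x \<in> ?E \<Longrightarrow> \<sigma> x = x" "x \<notin> ?E \<Longrightarrow> \<gamma> x = x"
        using p(3) \<gamma> disj unfolding permutes_def by blast+
      then show "?part ?E (\<gamma> \<circ> \<sigma>) x = \<gamma> x" by auto
    qed
    moreover have "?part ?Q (\<gamma> \<circ> \<sigma>) = \<sigma>"
    proof
      fix x
      have "x \<in> ?Q \<Longrightarrow> \<gamma> (\<sigma> x) = \<sigma> x" "x \<notin> ?Q \<Longrightarrow> \<sigma> x = x"
        using p(3) \<gamma> disj permutes_in_image[OF p(3), of x] unfolding permutes_def by blast+
      then show "?part ?Q (\<gamma> \<circ> \<sigma>) x = \<sigma> x" by auto
    qed
    ultimately show ?case by (simp only: p(1) prod.case)
  next
    case (4 p)
    obtain \<gamma> \<sigma> where p: "p = (\<gamma>,\<sigma>)" "\<gamma> \<in> column_group pss" "\<sigma> permutes ?Q" using 4 by auto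
    have \<gamma>: "\<gamma> permutes ?E" using p by (simp add: column_group_def)
    have "\<gamma> \<circ> \<sigma> permutes (?Q \<union> ?E)"
      using \<gamma> p(3) by (intro permutes_compose) (auto intro: permutes_subset)
    moreover have "(\<gamma> \<circ> \<sigma>) x \<in> ?Q" if "x \<in> ?Q" for x
    proof -
      have "\<sigma> x \<in> ?Q" using that p(3) by (simp add: permutes_in_image)
      moreover then have "\<gamma> (\<sigma> x) = \<sigma> x" using \<gamma> disj unfolding permutes_def by blast
      ultimately show ?thesis by simp
    qed
    moreover have "(\<gamma> \<circ> \<sigma>) x \<in> set qs" if "qs \<in> set pss" "x \<in> set qs" for qs x
    proof -
      have "x \<in> ?E" using that by auto
      then have "\<sigma> x = x" using p(3) disj unfolding permutes_def by blast
      then show ?thesis using p(2) that by (auto simp: column_group_def)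
    qed
    ultimately show ?case using p(1) by (auto simp: column_group_def)
  next
    case (5 \<gamma>)
    have "(?part ?E \<gamma> \<circ> ?part ?Q \<gamma>) x = \<gamma> x" for x
      using perm[OF 5] Qin[OF 5, of x] disj by (auto simp: permutes_def)
    then have "?part ?E \<gamma> \<circ> ?part ?Q \<gamma> = \<gamma>" by auto
    then show ?case by simp
  qed
  then show ?thesis by (simp add: sum.cartesian_product)
qed

text \<open>Alternating along a column that meets every row leaves a highest weight family on the
  remaining positions and costs only a positive factor, so columns can be removed one by one. The
  first alternative absorbs row lengths that are not weakly decreasing: then at some stage a letter
  has run out while a larger one is still present, and a raising relation with empty sum forces
  vanishing.\<close>

theorem highest_weight_column_alternation:
  assumes "finite D" "highest_weight D \<rho> \<Phi>"
  shows "(\<forall>v s. row_const D \<rho> v \<longrightarrow> \<Phi> v s = 0) \<or>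
    (\<exists>pss \<kappa>. \<kappa> > 0 \<and> [] \<notin> set pss \<and> distinct (concat pss) \<and> set (concat pss) = D \<and>
       (\<forall>ps\<in>set pss. map \<rho> ps = [0..<length ps]) \<and>
       (\<forall>v s. row_const D \<rho> v \<longrightarrow> complex_of_real \<kappa> * \<Phi> v s
           = (\<Sum>\<gamma>\<in>column_group pss. of_int (sign \<gamma>) * \<Phi> (v \<circ> \<gamma>) s)))"
  using assms
proof (induction "card D" arbitrary: D \<Phi> rule: less_induct)
  case less
  note fin = less.prems(1) and hw = less.prems(2)
  consider (empty) "D = {}" | (gap) b i where "b \<in> D" "i < \<rho> b" "i \<notin> \<rho> ` D"
    | (step) "D \<noteq> {}" "\<And>b i. b \<in> D \<Longrightarrow> i < \<rho> b \<Longrightarrow> i \<in> \<rho> ` D" by blast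
  then show ?case
  proof cases
    case empty
    then show ?thesis
      by (intro disjI2 exI[of _ "[]"] exI[of _ 1]) (simp add: column_group_Nil)
  next
    case gap
    have none: "{a. a \<in> D \<and> \<rho> a = i} = {}" using gap(3) by auto
    have "\<Phi> v s = 0" for v s
      using highest_weight_raise[OF hw gap(1,2), of v s, unfolded none] by simp
    then show ?thesis by simp
  next
    case step
    \<comment> \<open>No letter is skipped, so the letters in use are exactly those below
      \<open>m\<close>; \<open>ps\<close> will pick one position for each, in increasing
      order.\<close>
    define m where "m = Suc (Max (\<rho> ` D))"
    have "\<rho> ` D = {..<m}"
    proof
      show "\<rho> ` D \<subseteq> {..<m}" unfolding m_def using fin by (auto simp: less_Suc_eq_le)
      have "Max (\<rho> ` D) \<in> \<rho> ` D" using fin step(1) by (intro Max_in) auto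
      then show "{..<m} \<subseteq> \<rho> ` D" unfolding m_def
        using step(2) by (force simp: less_Suc_eq)
    qed
    note im = this
    define ps where "ps = map (inv_into D \<rho>) [0..<m]"
    let ?Q = "set ps"
    have inv: "inv_into D \<rho> l \<in> D" "\<rho> (inv_into D \<rho> l) = l" if "l < m" for l
      using that im by (auto intro: inv_into_into f_inv_into_f)
    have map: "map \<rho> ps = [0..<length ps]"
      unfolding ps_def by (rule nth_equalityI) (auto simp: inv)
    have dist: "distinct (map \<rho> ps)" unfolding map by simp
    have Q: "?Q \<subseteq> D" "inj_on \<rho> ?Q" "\<rho> ` ?Q = \<rho> ` D"
    proof -
      show "?Q \<subseteq> D" unfolding ps_def using inv by auto
      show "inj_on \<rho> ?Q" using dist by (simp add: distinct_map)
      have "\<rho> ` ?Q = set (map \<rho> ps)" by simp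
      also have "\<dots> = {..<m}" unfolding map by (auto simp: ps_def)
      finally show "\<rho> ` ?Q = \<rho> ` D" using im by simp
    qed
    have ne: "ps \<noteq> []" by (simp add: ps_def m_def)
    have lt: "card (D - ?Q) < card D"
      using fin Q(1) ne by (intro psubset_card_mono) (auto simp: neq_Nil_conv)
    have hw': "highest_weight (D - ?Q) \<rho> (alternate ?Q \<Phi>)"
      using highest_weight_alternate[OF fin hw Q] step(2) by blast
    note IH = less.hyps[OF lt finite_Diff[OF fin] hw']
    obtain \<kappa> where \<kappa>: "\<kappa> > 0"
      "\<And>v s. row_const D \<rho> v \<Longrightarrow> alternate ?Q \<Phi> v s = complex_of_real \<kappa> * \<Phi> v s"
      using alternate_scales[OF fin hw Q(1,2)] by blast
    have rc: "row_const (D - ?Q) \<rho> v" if "row_const D \<rho> v" for v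
      using that unfolding row_const_def by blast
    from IH consider
      (zero) "\<And>v s. row_const (D - ?Q) \<rho> v \<Longrightarrow> alternate ?Q \<Phi> v s = 0"
      | (cols) pss \<mu> where "\<mu> > 0" "[] \<notin> set pss" "distinct (concat pss)" "set (concat pss) = D - ?Q"
        "\<And>ps. ps \<in> set pss \<Longrightarrow> map \<rho> ps = [0..<length ps]"
        "\<And>v s. row_const (D - ?Q) \<rho> v \<Longrightarrow> complex_of_real \<mu> * alternate ?Q \<Phi> v s
           = (\<Sum>\<gamma>\<in>column_group pss. of_int (sign \<gamma>) * alternate ?Q \<Phi> (v \<circ> \<gamma>) s)"
      by blast
    then show ?thesis
    proof cases
      case zero
      then have "\<Phi> v s = 0" if "row_const D \<rho> v" for v s
        using \<kappa>(1) \<kappa>(2)[OF that, of s] rc[OF that] by simp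
      then show ?thesis by blast
    next
      case cols
      have disj: "?Q \<inter> set (concat pss) = {}" using cols(4) by auto
      have "complex_of_real (\<mu> * \<kappa>) * \<Phi> v s
          = (\<Sum>\<gamma>\<in>column_group (ps # pss). of_int (sign \<gamma>) * \<Phi> (v \<circ> \<gamma>) s)"
        if v: "row_const D \<rho> v" for v s
      proof -
        have "complex_of_real (\<mu> * \<kappa>) * \<Phi> v s
          = (\<Sum>\<gamma>\<in>column_group pss. of_int (sign \<gamma>) * alternate ?Q \<Phi> (v \<circ> \<gamma>) s)"
          using cols(6)[OF rc[OF v], of s] \<kappa>(2)[OF v, of s] by (simp add: mult.assoc)
        also have "\<dots> = (\<Sum>\<gamma>\<in>column_group pss. \<Sum>\<sigma> | \<sigma> permutes ?Q.
            of_int (sign (\<gamma> \<circ> \<sigma>)) * \<Phi> (v \<circ> (\<gamma> \<circ> \<sigma>)) s)"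
        proof (intro sum.cong refl)
          fix \<gamma> assume "\<gamma> \<in> column_group pss"
          then have \<gamma>: "permutation \<gamma>"
            using column_group_permutes permutation_permutes by blast
          have "sign (\<gamma> \<circ> \<sigma>) = sign \<gamma> * sign \<sigma>" if "\<sigma> permutes ?Q" for \<sigma>
            using that \<gamma> permutation_permutes by (intro sign_compose) auto
          then show "of_int (sign \<gamma>) * alternate ?Q \<Phi> (v \<circ> \<gamma>) s =
              (\<Sum>\<sigma> | \<sigma> permutes ?Q. of_int (sign (\<gamma> \<circ> \<sigma>)) * \<Phi> (v \<circ> (\<gamma> \<circ> \<sigma>)) s)"
            unfolding alternate_def sum_distrib_left
            by (intro sum.cong) (auto simp: comp_assoc)
        qed
        also have "\<dots> = (\<Sum>\<gamma>\<in>column_group (ps # pss). of_int (sign \<gamma>) * \<Phi> (v \<circ> \<gamma>) s)"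
          by (rule sum_column_group_Cons[OF disj, symmetric])
        finally show ?thesis .
      qed
      moreover have "distinct (concat (ps # pss))"
        using cols(3) disj dist by (simp add: distinct_map)
      moreover have "set (concat (ps # pss)) = D" using cols(4) Q(1) by auto
      ultimately show ?thesis using cols(1,2,5) \<kappa>(1) ne map
        by (intro disjI2 exI[of _ "ps # pss"] exI[of _ "\<mu> * \<kappa>"]) auto
    qed
  qed
qed

section \<open>Determinants, tensors and symmetrization\<close>

lemma det_mat_columns:
  "det (mat d d (\<lambda>(r,c). M r c)) =
     (\<Sum>\<pi> | \<pi> permutes {..<d}. of_int (sign \<pi>) * (\<Prod>c<d. M (\<pi> c) c))"
proof -
  have "det (mat d d (\<lambda>(r,c). M r c)) =
     (\<Sum>\<pi> | \<pi> permutes {0..<d}. of_int (sign \<pi>) * (\<Prod>c<d. mat d d (\<lambda>(r,c). M r c) $$ (\<pi> c, c)))"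
    by (rule det_col) simp
  also have "\<dots> = (\<Sum>\<pi> | \<pi> permutes {..<d}. of_int (sign \<pi>) * (\<Prod>c<d. M (\<pi> c) c))"
    unfolding atLeast0LessThan
  proof (intro sum.cong refl arg_cong2[where f="(*)"] prod.cong)
    fix \<pi> c assume "\<pi> \<in> {\<pi>. \<pi> permutes {..<d}}" "c \<in> {..<d}"
    then have "\<pi> c < d" "c < d" using permutes_in_image[of \<pi> "{..<d}" c] by auto
    then show "mat d d (\<lambda>(r,c). M r c) $$ (\<pi> c, c) = M (\<pi> c) c" by simp
  qed
  finally show ?thesis .
qed

lemma det_sum_columns:
  fixes M :: "nat \<Rightarrow> nat \<Rightarrow> 'x \<Rightarrow> 'a :: comm_ring_1"
  assumes "\<And>c. c < d \<Longrightarrow> finite (X c)"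
  shows "det (mat d d (\<lambda>(r,c). \<Sum>x\<in>X c. M r c x)) =
     (\<Sum>I\<in>PiE {..<d} X. det (mat d d (\<lambda>(r,c). M r c (I c))))"
proof -
  have "det (mat d d (\<lambda>(r,c). \<Sum>x\<in>X c. M r c x)) =
     (\<Sum>\<pi> | \<pi> permutes {..<d}. of_int (sign \<pi>) * (\<Sum>I\<in>PiE {..<d} X. \<Prod>c<d. M (\<pi> c) c (I c)))"
    unfolding det_mat_columns
    by (intro sum.cong refl arg_cong2[where f="(*)"] prod_sum_PiE) (use assms in auto)
  then show ?thesis
    unfolding det_mat_columns sum_distrib_left by (subst sum.swap) simp
qed

lemma det_scale_columns:
  fixes M :: "nat \<Rightarrow> nat \<Rightarrow> 'a :: comm_ring_1"
  shows "det (mat d d (\<lambda>(r,c). k c * M r c)) = (\<Prod>c<d. k c) * det (mat d d (\<lambda>(r,c). M r c))"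
  unfolding det_mat_columns
  by (simp add: prod.distrib sum_distrib_left mult.left_commute)

lemma det_permute_columns:
  fixes M :: "nat \<Rightarrow> nat \<Rightarrow> 'a :: comm_ring_1"
  assumes \<sigma>: "\<sigma> permutes {..<d}"
  shows "det (mat d d (\<lambda>(r,c). M r (\<sigma> c))) = of_int (sign \<sigma>) * det (mat d d (\<lambda>(r,c). M r c))"
proof -
  let ?P = "{\<pi>. \<pi> permutes {..<d}}"
  have "det (mat d d (\<lambda>(r,c). M r (\<sigma> c))) =
      (\<Sum>\<pi>\<in>?P. of_int (sign \<pi>) * (\<Prod>c<d. M (\<pi> c) (\<sigma> c)))"
    by (rule det_mat_columns)
  also have "\<dots> = (\<Sum>\<pi>\<in>?P. of_int (sign (\<pi> \<circ> \<sigma>)) * (\<Prod>c<d. M ((\<pi> \<circ> \<sigma>) c) (\<sigma> c)))"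
    by (rule sum.reindex_bij_witness[of _ "\<lambda>\<pi>. \<pi> \<circ> \<sigma>" "\<lambda>\<pi>. \<pi> \<circ> Hilbert_Choice.inv \<sigma>"])
       (use \<sigma> in \<open>auto simp: comp_assoc permutes_inv_o intro: permutes_compose permutes_inv\<close>)
  also have "\<dots> = (\<Sum>\<pi>\<in>?P. of_int (sign \<sigma>) * (of_int (sign \<pi>) * (\<Prod>c<d. M (\<pi> c) c)))"
  proof (rule sum.cong[OF refl])
    fix \<pi> assume "\<pi> \<in> ?P"
    then have "sign (\<pi> \<circ> \<sigma>) = sign \<pi> * sign \<sigma>"
      using \<sigma> by (intro sign_compose) (auto simp: permutation_permutes)
    moreover have "(\<Prod>c<d. M (\<pi> (\<sigma> c)) (\<sigma> c)) = (\<Prod>c<d. M (\<pi> c) c)"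
      using prod.permute[OF \<sigma>, of "\<lambda>c. M (\<pi> c) c"] by (simp add: o_def)
    ultimately show "of_int (sign (\<pi> \<circ> \<sigma>)) * (\<Prod>c<d. M ((\<pi> \<circ> \<sigma>) c) (\<sigma> c)) =
        of_int (sign \<sigma>) * (of_int (sign \<pi>) * (\<Prod>c<d. M (\<pi> c) c))"
      by (simp add: algebra_simps)
  qed
  finally show ?thesis by (simp add: det_mat_columns sum_distrib_left)
qed

lemma det_block_diagonal:
  fixes M :: "nat \<Rightarrow> nat \<Rightarrow> nat \<Rightarrow> 'a :: idom"
  assumes n: "n > 0"
  shows "det (mat (K * n) (K * n)
       (\<lambda>(r,c). if r div n = c div n then M (c div n) (r mod n) (c mod n) else 0)) =
     (\<Prod>q<K. det (mat n n (\<lambda>(r,c). M q r c)))"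
proof (induction K)
  case (Suc K)
  let ?f = "\<lambda>(r,c). if r div n = c div n then M (c div n) (r mod n) (c mod n) else 0"
  have q: "x < K * n \<Longrightarrow> x div n < K" for x using n by (simp add: less_mult_imp_div_less)
  have le: "x div n = K" if "\<not> x < K * n" "x < Suc K * n" for x
    using that n by (intro div_nat_eqI) (auto simp: mult.commute)
  have md: "x - K * n = x mod n" if "\<not> x < K * n" "x < Suc K * n" for x
    using le[OF that] minus_div_mult_eq_mod[of x n] by simp
  have "mat (Suc K * n) (Suc K * n) ?f =
      four_block_mat (mat (K * n) (K * n) ?f) (0\<^sub>m (K * n) n) (0\<^sub>m n (K * n)) (mat n n (\<lambda>(r,c). M K r c))"
    (is "?L = ?R")
  proof (rule eq_matI)
    fix i j assume "i < dim_row ?R" "j < dim_col ?R"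
    then have ij: "i < Suc K * n" "j < Suc K * n" by simp_all
    show "?L $$ (i,j) = ?R $$ (i,j)"
    proof (cases "i < K * n"; cases "j < K * n")
      assume "i < K * n" "j < K * n"
      then show ?thesis using ij by simp
    next
      assume a: "i < K * n" "\<not> j < K * n"
      then show ?thesis using ij q[OF a(1)] le[OF a(2) ij(2)] by simp
    next
      assume a: "\<not> i < K * n" "j < K * n"
      then show ?thesis using ij q[OF a(2)] le[OF a(1) ij(1)] by simp
    next
      assume a: "\<not> i < K * n" "\<not> j < K * n"
      then show ?thesis
        using ij n le[OF a(1) ij(1)] le[OF a(2) ij(2)] by (simp add: md[OF a(1)] md[OF a(2)])
    qed
  qed simp_all
  then show ?case
    using Suc.IH by (simp only: det_four_block_mat_lower_left_zero[of _ "K * n" _ n] mat_carrier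
        zero_carrier_mat prod.lessThan_Suc)
qed simp

text \<open>Toggling a point of \<open>P - T\<close> is a sign-reversing involution on the sets
  summed over.\<close>

lemma alternating_sum_supersets:
  assumes "finite P" "T \<subseteq> P"
  shows "(\<Sum>S | T \<subseteq> S \<and> S \<subseteq> P. (-1) ^ card (P - S)) = (if T = P then 1 else 0 :: complex)"
proof (cases "T = P")
  case True
  then have "{S. T \<subseteq> S \<and> S \<subseteq> P} = {P}" by auto
  then show ?thesis using True by simp
next
  case False
  then obtain x where x: "x \<in> P" "x \<notin> T" using assms by auto
  let ?F = "{S. T \<subseteq> S \<and> S \<subseteq> P}"
  define t where "t = (\<lambda>S. if x \<in> S then S - {x} else insert x S)"
  have tt: "t (t S) = S" for S by (auto simp: t_def)
  have tF: "t S \<in> ?F" if "S \<in> ?F" for S using that x by (auto simp: t_def)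
  have sg: "(-1::complex) ^ card (P - t S) = - ((-1) ^ card (P - S))" if "S \<in> ?F" for S
  proof (cases "x \<in> S")
    case True
    then have "P - t S = insert x (P - S)" using x by (auto simp: t_def)
    then show ?thesis using assms True by simp
  next
    case F: False
    then have "P - S = insert x (P - t S)" "x \<notin> P - t S" using x by (auto simp: t_def)
    then show ?thesis using assms by simp
  qed
  have "(\<Sum>S\<in>?F. (-1::complex) ^ card (P - S)) = (\<Sum>S\<in>?F. (-1) ^ card (P - t S))"
    by (rule sum.reindex_bij_witness[of _ t t]) (use tt tF in auto)
  also have "\<dots> = - (\<Sum>S\<in>?F. (-1) ^ card (P - S))"
    unfolding sum_negf[symmetric] by (rule sum.cong) (use sg in auto)
  finally show ?thesis using False by simp
qed

text \<open>A map is counted with a sign for every \<open>S\<close> between its image and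
  \<open>P\<close>, and these signs cancel unless the image is all of \<open>P\<close>. A surjection
  of a finite set onto itself is a permutation; \<open>restrict\<close> only reconciles the values
  outside \<open>P\<close>.\<close>

lemma inclusion_exclusion_permutations:
  fixes f :: "('b \<Rightarrow> 'b) \<Rightarrow> complex"
  assumes fin: "finite P"
  shows "(\<Sum>S\<in>Pow P. (-1) ^ card (P - S) * (\<Sum>\<tau>\<in>P \<rightarrow>\<^sub>E S. f \<tau>)) =
     (\<Sum>\<pi> | \<pi> permutes P. f (restrict \<pi> P))"
proof -
  have "(\<Sum>S\<in>Pow P. (-1) ^ card (P - S) * (\<Sum>\<tau>\<in>P \<rightarrow>\<^sub>E S. f \<tau>))
      = (\<Sum>S\<in>Pow P. \<Sum>\<tau>\<in>P \<rightarrow>\<^sub>E P. if \<tau> ` P \<subseteq> S then (-1) ^ card (P - S) * f \<tau> else 0)"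
    using fin
    by (auto simp: sum_distrib_left sum.inter_filter[symmetric] finite_PiE intro!: sum.cong)
  also have "\<dots> = (\<Sum>\<tau>\<in>P \<rightarrow>\<^sub>E P. (\<Sum>S | \<tau> ` P \<subseteq> S \<and> S \<subseteq> P. (-1) ^ card (P - S)) * f \<tau>)"
    using fin
    by (subst sum.swap) (auto simp: sum_distrib_right sum.inter_filter[symmetric] intro!: sum.cong)
  also have "\<dots> = (\<Sum>\<tau>\<in>P \<rightarrow>\<^sub>E P. if \<tau> ` P = P then f \<tau> else 0)"
  proof (rule sum.cong[OF refl])
    fix \<tau> assume "\<tau> \<in> P \<rightarrow>\<^sub>E P"
    then have "\<tau> ` P \<subseteq> P" by auto
    from alternating_sum_supersets[OF fin this]
    show "(\<Sum>S | \<tau> ` P \<subseteq> S \<and> S \<subseteq> P. (-1) ^ card (P - S)) * f \<tau> =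
        (if \<tau> ` P = P then f \<tau> else 0)" by simp
  qed
  also have "\<dots> = (\<Sum>\<tau> | \<tau> \<in> P \<rightarrow>\<^sub>E P \<and> \<tau> ` P = P. f \<tau>)"
    using fin by (simp add: sum.inter_filter finite_PiE)
  also have "\<dots> = (\<Sum>\<pi> | \<pi> permutes P. f (restrict \<pi> P))"
  proof (rule sum.reindex_bij_witness[of _ "\<lambda>\<pi>. restrict \<pi> P" "\<lambda>\<tau> x. if x \<in> P then \<tau> x else x"], goal_cases)
    case (2 \<tau>)
    then have "bij_betw \<tau> P P" using fin by (simp add: bij_betw_def eq_card_imp_inj_on)
    then show ?case by (auto intro!: bij_imp_permutes cong: bij_betw_cong)
  next
    case (3 \<pi>)
    then show ?case by (auto simp: permutes_def)
  next
    case (4 \<pi>)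
    then show ?case by (auto simp: permutes_in_image permutes_image)
  next
    case (5 \<tau>)
    then have "restrict (\<lambda>x. if x \<in> P then \<tau> x else x) P = \<tau>"
      by (auto simp: fun_eq_iff PiE_def extensional_def)
    then show ?case by simp
  qed (auto simp: fun_eq_iff PiE_def extensional_def restrict_def)
  finally show ?thesis .
qed

text \<open>Polarization of the determinant: expanding a subset sum column by column yields all maps
  from columns to \<open>S\<close>, and inclusion-exclusion keeps those that use every index exactly
  once.\<close>

lemma mixed_discriminant:
  "(\<Sum>S\<in>Pow {..<d}. (-1) ^ card ({..<d} - S) * det (mat d d (\<lambda>(r,c). \<Sum>p\<in>S. M p r c))) =
   (\<Sum>\<pi> | \<pi> permutes {..<d}. det (mat d d (\<lambda>(r,c). M (\<pi> c) r c)) :: complex)"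
proof -
  have "(\<Sum>S\<in>Pow {..<d}. (-1) ^ card ({..<d} - S) * det (mat d d (\<lambda>(r,c). \<Sum>p\<in>S. M p r c)))
     = (\<Sum>S\<in>Pow {..<d}. (-1) ^ card ({..<d} - S) *
          (\<Sum>\<tau>\<in>{..<d} \<rightarrow>\<^sub>E S. det (mat d d (\<lambda>(r,c). M (\<tau> c) r c))))"
    by (intro sum.cong refl, subst det_sum_columns) (auto intro: finite_subset)
  also have "\<dots> = (\<Sum>\<pi> | \<pi> permutes {..<d}. det (mat d d (\<lambda>(r,c). M (restrict \<pi> {..<d} c) r c)))"
    by (rule inclusion_exclusion_permutations) simp
  also have "\<dots> = (\<Sum>\<pi> | \<pi> permutes {..<d}. det (mat d d (\<lambda>(r,c). M (\<pi> c) r c)))"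
    by (intro sum.cong refl arg_cong[where f=det] eq_matI) auto
  finally show ?thesis .
qed

text \<open>A form that vanishes identically has zero coefficients, shown by polarization: it is
  evaluated at sums of matrix units, one for each position in \<open>S\<close>, and
  inclusion-exclusion over \<open>S\<close> retains the bijective assignments of positions. Pairs of
  words with the same monomial differ by a simultaneous permutation, hence the sum over
  \<open>\<tau>\<close>.\<close>

lemma symmetrized_coefficient_zero:
  fixes A :: "(nat \<Rightarrow> nat) \<Rightarrow> (nat \<Rightarrow> nat) \<Rightarrow> complex"
  assumes zero: "\<And>g. (\<Sum>I\<in>{..<d} \<rightarrow>\<^sub>E {..<n}. \<Sum>J\<in>{..<d} \<rightarrow>\<^sub>E {..<n}. A I J * (\<Prod>p<d. g (I p) (J p))) = 0"
    and v: "v \<in> {..<d} \<rightarrow>\<^sub>E {..<n}" and \<rho>: "\<rho> \<in> {..<d} \<rightarrow>\<^sub>E {..<n}"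
  shows "(\<Sum>\<tau> | \<tau> permutes {..<d}. A (v \<circ> \<tau>) (\<rho> \<circ> \<tau>)) = 0"
proof -
  let ?P = "{..<d}" and ?W = "{..<d} \<rightarrow>\<^sub>E {..<n}"
  let ?f = "\<lambda>\<tau>. A (restrict (v \<circ> \<tau>) ?P) (restrict (\<rho> \<circ> \<tau>) ?P)"
  have eq: "(\<Sum>\<tau>\<in>?P \<rightarrow>\<^sub>E S. ?f \<tau>) = 0" if S: "S \<subseteq> ?P" for S
  proof -
    have finS: "finite S" using S finite_subset by blast
    have in_W: "restrict (w \<circ> \<tau>) ?P \<in> ?W" if "w \<in> ?W" "\<tau> \<in> ?P \<rightarrow>\<^sub>E S" for w \<tau>
      using that S by (fastforce simp: PiE_def Pi_def)
    \<comment> \<open>The sum of the matrix units at \<open>(v p, \<rho> p)\<close> for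
      \<open>p\<close> in \<open>S\<close>; a product of its entries counts the ways to match
      positions with elements of \<open>S\<close>.\<close>
    let ?g = "\<lambda>x y. \<Sum>p\<in>S. if v p = x \<and> \<rho> p = y then 1 else 0 :: complex"
    have "(\<Prod>p<d. ?g (I p) (J p)) = (\<Sum>\<tau>\<in>?P \<rightarrow>\<^sub>E S.
        if I = restrict (v \<circ> \<tau>) ?P \<and> J = restrict (\<rho> \<circ> \<tau>) ?P then 1 else 0)"
      if "I \<in> ?W" "J \<in> ?W" for I J
    proof -
      have "(\<Prod>p<d. ?g (I p) (J p)) =
          (\<Sum>\<tau>\<in>?P \<rightarrow>\<^sub>E S. \<Prod>p<d. if v (\<tau> p) = I p \<and> \<rho> (\<tau> p) = J p then 1 else 0)"
        using finS by (subst prod_sum_PiE) auto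
      also have "\<dots> = (\<Sum>\<tau>\<in>?P \<rightarrow>\<^sub>E S.
          if I = restrict (v \<circ> \<tau>) ?P \<and> J = restrict (\<rho> \<circ> \<tau>) ?P then 1 else 0)"
      proof (rule sum.cong[OF refl])
        fix \<tau> assume "\<tau> \<in> ?P \<rightarrow>\<^sub>E S"
        have "(I = restrict (v \<circ> \<tau>) ?P \<and> J = restrict (\<rho> \<circ> \<tau>) ?P) =
            (\<forall>p<d. v (\<tau> p) = I p \<and> \<rho> (\<tau> p) = J p)"
          using that by (fastforce simp: fun_eq_iff PiE_def extensional_def)
        then show "(\<Prod>p<d. if v (\<tau> p) = I p \<and> \<rho> (\<tau> p) = J p then 1 else 0 :: complex) =
           (if I = restrict (v \<circ> \<tau>) ?P \<and> J = restrict (\<rho> \<circ> \<tau>) ?P then 1 else 0)"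
          by (auto intro!: prod.neutral prod_zero)
      qed
      finally show ?thesis .
    qed
    then have "0 = (\<Sum>I\<in>?W. \<Sum>J\<in>?W. \<Sum>\<tau>\<in>?P \<rightarrow>\<^sub>E S.
        if I = restrict (v \<circ> \<tau>) ?P \<and> J = restrict (\<rho> \<circ> \<tau>) ?P then A I J else 0)"
      using zero[of ?g] by (simp add: sum_distrib_left if_distrib cong: if_cong sum.cong)
    also have "\<dots> = (\<Sum>\<tau>\<in>?P \<rightarrow>\<^sub>E S. \<Sum>I\<in>?W. \<Sum>J\<in>?W.
        if I = restrict (v \<circ> \<tau>) ?P \<and> J = restrict (\<rho> \<circ> \<tau>) ?P then A I J else 0)"
      by (subst (2) sum.swap, subst sum.swap) (rule refl)
    also have "\<dots> = (\<Sum>\<tau>\<in>?P \<rightarrow>\<^sub>E S. ?f \<tau>)"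
    proof (rule sum.cong[OF refl])
      fix \<tau> assume \<tau>: "\<tau> \<in> ?P \<rightarrow>\<^sub>E S"
      have "(\<Sum>I\<in>?W. \<Sum>J\<in>?W.
          if I = restrict (v \<circ> \<tau>) ?P \<and> J = restrict (\<rho> \<circ> \<tau>) ?P then A I J else 0) =
        (\<Sum>I\<in>?W. if I = restrict (v \<circ> \<tau>) ?P then \<Sum>J\<in>?W. if J = restrict (\<rho> \<circ> \<tau>) ?P then A I J else 0 else 0)"
        by (intro sum.cong refl) auto
      also have "\<dots> = ?f \<tau>"
        using in_W[OF v \<tau>] in_W[OF \<rho> \<tau>] by (simp add: sum.delta finite_PiE)
      finally show "(\<Sum>I\<in>?W. \<Sum>J\<in>?W.
          if I = restrict (v \<circ> \<tau>) ?P \<and> J = restrict (\<rho> \<circ> \<tau>) ?P then A I J else 0) = ?f \<tau>" .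
    qed
    finally show ?thesis by simp
  qed
  have "(\<Sum>\<tau> | \<tau> permutes ?P. ?f (restrict \<tau> ?P)) = 0"
    by (subst inclusion_exclusion_permutations[symmetric]) (simp_all add: eq)
  moreover have "?f (restrict \<tau> ?P) = A (v \<circ> \<tau>) (\<rho> \<circ> \<tau>)" if "\<tau> permutes ?P" for \<tau>
  proof -
    have "restrict (w \<circ> restrict \<tau> ?P) ?P = w \<circ> \<tau>" if "w \<in> ?W" for w
      using \<open>\<tau> permutes ?P\<close> that
      by (auto simp: fun_eq_iff PiE_def extensional_def permutes_def)
    then show ?thesis using v \<rho> by simp
  qed
  ultimately show ?thesis by simp
qed

section \<open>Raising operators on the coefficients of an invariant form\<close>

lemma coeff_1_prod_linear:
  assumes "finite P"
  shows "coeff (\<Prod>p\<in>P. [:a p, b p:]) 1 = (\<Sum>p\<in>P. b p * (\<Prod>q\<in>P - {p}. a q))"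
proof -
  have c0: "coeff (\<Prod>p\<in>P. [:a p, b p:]) 0 = (\<Prod>p\<in>P. a p)" for P :: "'a set"
    by (induction P rule: infinite_finite_induct) (simp_all add: coeff_mult)
  show ?thesis using assms
  proof (induction P rule: finite_induct)
    case (insert x P)
    have "(\<Prod>q\<in>insert x P - {p}. a q) = a x * (\<Prod>q\<in>P - {p}. a q)" if "p \<in> P" for p
    proof -
      have "insert x P - {p} = insert x (P - {p})" using that insert.hyps by auto
      then show ?thesis using insert.hyps by simp
    qed
    then show ?case using insert c0[of P]
      by (simp add: sum_distrib_left algebra_simps coeff_pCons)
  qed simp
qed

lemma PiE_comp_permutes:
  assumes \<tau>: "\<tau> permutes {..<d :: nat}" and w: "w \<in> {..<d} \<rightarrow>\<^sub>E X"
  shows "w \<circ> \<tau> \<in> {..<d} \<rightarrow>\<^sub>E X"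
proof (rule PiE_I)
  fix x assume "x \<in> {..<d}"
  then have "\<tau> x \<in> {..<d}" using \<tau> by (simp only: permutes_in_image)
  then show "(w \<circ> \<tau>) x \<in> X" using w by auto
next
  fix x assume x: "x \<notin> {..<d}"
  then have "\<tau> x = x" using \<tau> by (rule permutes_not_in[rotated])
  then show "(w \<circ> \<tau>) x = undefined" using PiE_arb[OF w x] by simp
qed

text \<open>Right multiplication of \<open>g\<close> by \<open>1 + z E\<^sub>i\<^sub>j\<close>.\<close>

definition elementary_action :: "nat \<Rightarrow> nat \<Rightarrow> 'a::comm_ring_1 \<Rightarrow> (nat \<Rightarrow> nat \<Rightarrow> 'a) \<Rightarrow> nat \<Rightarrow> nat \<Rightarrow> 'a" where
  "elementary_action i j z g = (\<lambda>x y. g x y + (if y = j then z * g x i else 0))"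

text \<open>The coefficient ring is left general because the form is also evaluated over polynomials
  in an auxiliary variable.\<close>

definition tensor_form ::
  "nat \<Rightarrow> nat \<Rightarrow> ((nat \<Rightarrow> nat) \<Rightarrow> (nat \<Rightarrow> nat) \<Rightarrow> 'a::comm_ring_1) \<Rightarrow> (nat \<Rightarrow> nat \<Rightarrow> 'a) \<Rightarrow> 'a" where
  "tensor_form d n A g =
     (\<Sum>I\<in>{..<d} \<rightarrow>\<^sub>E {..<n}. \<Sum>J\<in>{..<d} \<rightarrow>\<^sub>E {..<n}. A I J * (\<Prod>p<d. g (I p) (J p)))"

text \<open>Along the one-parameter family the form is a polynomial in \<open>z\<close> with
  constant value, so its linear coefficient vanishes. That coefficient replaces one factor
  \<open>g x j\<close> by \<open>g x i\<close>; moving the replacement from the monomial to the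
  tensor reverses it, so that positions with letter \<open>i\<close> receive
  \<open>j\<close>.\<close>

lemma tensor_form_derivative:
  fixes A :: "(nat \<Rightarrow> nat) \<Rightarrow> (nat \<Rightarrow> nat) \<Rightarrow> complex"
  assumes inv: "\<And>z. tensor_form d n A (elementary_action i j z g) = tensor_form d n A g"
    and ij: "i < n" "j < n"
  shows "tensor_form d n
     (\<lambda>I J. \<Sum>p | p < d \<and> J p = i. A I (J(p := j))) g = 0"
proof -
  let ?W = "{..<d} \<rightarrow>\<^sub>E {..<n}"
  \<comment> \<open>The form as a polynomial in \<open>z\<close>: only factors with column letter
    \<open>j\<close> depend on \<open>z\<close>.\<close>
  define Q where "Q = (\<Sum>I\<in>?W. \<Sum>J\<in>?W. smult (A I J)
     (\<Prod>p<d. [:g (I p) (J p), if J p = j then g (I p) i else 0:]))"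
  have "poly Q z = poly [:tensor_form d n A g:] z" for z
    using inv[of z] unfolding Q_def tensor_form_def elementary_action_def
    by (simp add: poly_sum poly_prod if_distrib[where f="\<lambda>x. z * x"] cong: if_cong)
  then have "Q = [:tensor_form d n A g:]" by (simp add: poly_eq_poly_eq_iff[symmetric] fun_eq_iff)
  then have "0 = coeff Q 1" by simp
  also have "\<dots> = (\<Sum>I\<in>?W. \<Sum>J\<in>?W. \<Sum>p<d.
      A I J * ((if J p = j then g (I p) i else 0) * (\<Prod>q\<in>{..<d} - {p}. g (I q) (J q))))"
    unfolding Q_def by (simp only: coeff_sum coeff_smult coeff_1_prod_linear finite_lessThan sum_distrib_left)
  also have "\<dots> = (\<Sum>I\<in>?W. \<Sum>p<d. \<Sum>J\<in>?W.
      if J p = j then A I J * (g (I p) i * (\<Prod>q\<in>{..<d} - {p}. g (I q) (J q))) else 0)"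
    by (rule sum.cong[OF refl], subst sum.swap, intro sum.cong refl) simp
  also have "\<dots> = (\<Sum>I\<in>?W. \<Sum>p<d. \<Sum>J\<in>?W.
      if J p = i then A I (J(p := j)) * (\<Prod>q<d. g (I q) (J q)) else 0)"
  proof (rule sum.cong[OF refl], rule sum.cong[OF refl])
    fix I p assume p: "p \<in> {..<d}"
    have upd: "J(p := x) \<in> ?W" if "J \<in> ?W" "x < n" for J x
      using that p by (auto simp: PiE_def Pi_def extensional_def)
    have "(\<Sum>J | J \<in> ?W \<and> J p = j. A I J * (g (I p) i * (\<Prod>q\<in>{..<d} - {p}. g (I q) (J q))))
        = (\<Sum>J | J \<in> ?W \<and> J p = i. A I (J(p := j)) * (\<Prod>q<d. g (I q) (J q)))"
    proof (rule sum.reindex_bij_witness[of _ "\<lambda>J. J(p := j)" "\<lambda>J. J(p := i)"], goal_cases)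
      case (1 J)
      then show ?case by (auto simp: fun_upd_idem)
    next
      case (2 J)
      then show ?case using upd[OF _ ij(1)] by simp
    next
      case (3 J)
      then show ?case by (auto simp: fun_upd_idem)
    next
      case (4 J)
      then show ?case using upd[OF _ ij(2)] by simp
    next
      case (5 J)
      have "(\<Prod>q<d. g (I q) ((J(p := i)) q)) = g (I p) i * (\<Prod>q\<in>{..<d} - {p}. g (I q) (J q))"
        using p by (subst prod.remove[of _ p]) auto
      moreover have "J(p := i, p := j) = J" using 5 by auto
      ultimately show ?case by simp
    qed
    then show "(\<Sum>J\<in>?W. if J p = j then A I J * (g (I p) i * (\<Prod>q\<in>{..<d} - {p}. g (I q) (J q))) else 0)
        = (\<Sum>J\<in>?W. if J p = i then A I (J(p := j)) * (\<Prod>q<d. g (I q) (J q)) else 0)"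
      by (simp add: sum.inter_filter[symmetric] finite_PiE)
  qed
  also have "\<dots> = tensor_form d n (\<lambda>I J. \<Sum>p | p < d \<and> J p = i. A I (J(p := j))) g"
    unfolding tensor_form_def
  proof (intro sum.cong refl, subst sum.swap, intro sum.cong refl)
    fix I J
    have "(\<Sum>p | p < d \<and> J p = i. A I (J(p := j))) = (\<Sum>p<d. if J p = i then A I (J(p := j)) else 0)"
      by (simp add: sum.inter_filter[symmetric] lessThan_def[symmetric] Collect_conj_eq)
    then show "(\<Sum>p<d. if J p = i then A I (J(p := j)) * (\<Prod>q<d. g (I q) (J q)) else 0) =
      (\<Sum>p | p < d \<and> J p = i. A I (J(p := j))) * (\<Prod>q<d. g (I q) (J q))"
      by (simp add: sum_distrib_right if_distrib[where f="\<lambda>x. x * _"] cong: if_cong)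
  qed
  finally show ?thesis by simp
qed

text \<open>Up to the order of the stabilizer of the pair of words, this is the coefficient of the
  monomial \<open>\<Prod>p<d. g (v p) (\<rho> p)\<close>, which determines the pair only up to a
  simultaneous permutation. The column word \<open>\<rho>\<close> comes first because it stays fixed
  while \<open>v\<close> varies.\<close>

definition symmetrize ::
  "nat \<Rightarrow> ((nat \<Rightarrow> nat) \<Rightarrow> (nat \<Rightarrow> nat) \<Rightarrow> complex) \<Rightarrow> (nat \<Rightarrow> nat) \<Rightarrow> (nat \<Rightarrow> nat) \<Rightarrow> complex" where
  "symmetrize d A \<rho> v = (\<Sum>\<tau> | \<tau> permutes {..<d}. A (v \<circ> \<tau>) (\<rho> \<circ> \<tau>))"

lemma symmetrize_equivariant:
  assumes \<pi>: "\<pi> permutes {..<d}"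
  shows "symmetrize d A (\<rho> \<circ> \<pi>) (v \<circ> \<pi>) = symmetrize d A \<rho> v"
  unfolding symmetrize_def
proof (rule sum.reindex_bij_witness[of _ "\<lambda>\<tau>. Hilbert_Choice.inv \<pi> \<circ> \<tau>" "\<lambda>\<tau>. \<pi> \<circ> \<tau>"], goal_cases)
  case (1 \<tau>)
  show ?case by (simp add: o_assoc permutes_inv_o[OF \<pi>])
next
  case (3 \<tau>)
  show ?case by (simp add: o_assoc permutes_inv_o[OF \<pi>])
qed (use \<pi> in \<open>simp_all add: o_assoc permutes_compose permutes_inv\<close>)

text \<open>The form of the raised tensor vanishes, hence so do its symmetrized coefficients.
  Replacing the letter at \<open>p\<close> in \<open>\<rho> \<circ> \<tau>\<close> means replacing
  it at \<open>a = \<tau> p\<close> in \<open>\<rho>\<close>, which frees the inner index set from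
  \<open>\<tau>\<close>.\<close>

lemma symmetrize_raise:
  assumes inv: "\<And>z g. tensor_form d n A (elementary_action i j z g) = tensor_form d n A g"
    and ij: "i < n" "j < n"
    and v: "v \<in> {..<d} \<rightarrow>\<^sub>E {..<n}" and \<rho>: "\<rho> \<in> {..<d} \<rightarrow>\<^sub>E {..<n}"
  shows "(\<Sum>a | a < d \<and> \<rho> a = i. symmetrize d A (\<rho>(a := j)) v) = 0"
proof -
  let ?P = "{\<tau>. \<tau> permutes {..<d}}"
  have "(\<Sum>\<tau>\<in>?P. \<Sum>p | p < d \<and> (\<rho> \<circ> \<tau>) p = i. A (v \<circ> \<tau>) ((\<rho> \<circ> \<tau>)(p := j))) = 0"
    using symmetrized_coefficient_zero[OF tensor_form_derivative[OF inv ij, unfolded tensor_form_def] v \<rho>] .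
  also have "(\<Sum>\<tau>\<in>?P. \<Sum>p | p < d \<and> (\<rho> \<circ> \<tau>) p = i. A (v \<circ> \<tau>) ((\<rho> \<circ> \<tau>)(p := j)))
      = (\<Sum>\<tau>\<in>?P. \<Sum>a | a < d \<and> \<rho> a = i. A (v \<circ> \<tau>) (\<rho>(a := j) \<circ> \<tau>))"
  proof (rule sum.cong[OF refl])
    fix \<tau> assume \<tau>: "\<tau> \<in> ?P"
    have upd: "(\<rho> \<circ> \<tau>)(p := j) = \<rho>(\<tau> p := j) \<circ> \<tau>" for p
      using permutes_inj[of \<tau>] \<tau> by (auto simp: fun_eq_iff dest: injD)
    have lt: "\<tau> p < d \<longleftrightarrow> p < d" for p using permutes_in_image[of \<tau> "{..<d}" p] \<tau> by simp
    show "(\<Sum>p | p < d \<and> (\<rho> \<circ> \<tau>) p = i. A (v \<circ> \<tau>) ((\<rho> \<circ> \<tau>)(p := j)))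
        = (\<Sum>a | a < d \<and> \<rho> a = i. A (v \<circ> \<tau>) (\<rho>(a := j) \<circ> \<tau>))"
    proof (rule sum.reindex_bij_witness[of _ "Hilbert_Choice.inv \<tau>" \<tau>], goal_cases)
      case (4 a)
      then show ?case using \<tau> lt[of "Hilbert_Choice.inv \<tau> a"] by (simp add: permutes_inverses)
    qed (use \<tau> lt upd in \<open>simp_all add: permutes_inverses\<close>)
  qed
  also have "\<dots> = (\<Sum>a | a < d \<and> \<rho> a = i. symmetrize d A (\<rho>(a := j)) v)"
    unfolding symmetrize_def by (rule sum.swap)
  finally show ?thesis .
qed

text \<open>The raising relation is taken at the word \<open>\<rho>(b := i)\<close>: restoring the
  letter \<open>\<rho> b\<close> at \<open>b\<close> gives \<open>\<rho>\<close>, and placing it at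
  a position \<open>a\<close> of row \<open>i\<close> gives
  \<open>\<rho> \<circ> transpose a b\<close>. Equivariance then moves the swap from
  \<open>\<rho>\<close> to \<open>v\<close>.\<close>

lemma highest_weight_symmetrize:
  fixes A :: "'s \<Rightarrow> (nat \<Rightarrow> nat) \<Rightarrow> (nat \<Rightarrow> nat) \<Rightarrow> complex"
  assumes inv: "\<And>s i j z g. i < j \<Longrightarrow> j < n \<Longrightarrow>
      tensor_form d n (A s) (elementary_action i j z g) = tensor_form d n (A s) g"
    and supp: "\<And>s I J. I \<notin> {..<d} \<rightarrow>\<^sub>E {..<n} \<Longrightarrow> A s I J = 0"
    and \<rho>: "\<rho> \<in> {..<d} \<rightarrow>\<^sub>E {..<n}"
  shows "highest_weight {..<d} \<rho> (\<lambda>v s. symmetrize d (A s) \<rho> v)"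
  unfolding highest_weight_def
proof (intro conjI ballI allI impI)
  fix a b v s assume ab: "a \<in> {..<d}" "b \<in> {..<d}" "\<rho> a = \<rho> b"
  have "\<rho> \<circ> transpose a b = \<rho>" using ab by (auto simp: fun_eq_iff transpose_def)
  then show "symmetrize d (A s) \<rho> (v \<circ> transpose a b) = symmetrize d (A s) \<rho> v"
    using symmetrize_equivariant[of "transpose a b" d "A s" \<rho> v] ab
    by (simp add: permutes_swap_id)
next
  fix b i v s assume b: "b \<in> {..<d}" and i: "i < \<rho> b"
  let ?W = "{..<d} \<rightarrow>\<^sub>E {..<n}"
  define j where "j = \<rho> b"
  have j: "j < n" using \<rho> b by (auto simp: j_def)
  show "symmetrize d (A s) \<rho> v +
     (\<Sum>a | a \<in> {..<d} \<and> \<rho> a = i. symmetrize d (A s) \<rho> (v \<circ> transpose a b)) = 0"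
  proof (cases "v \<in> ?W")
    \<comment> \<open>A word outside \<open>?W\<close> is not seen by the form, but all its
      permutations are outside too, so \<open>supp\<close> makes every term zero.\<close>
    case False
    have "w \<notin> ?W" if "w = v \<circ> \<tau>" "\<tau> permutes {..<d}" for \<tau> w
    proof
      assume "w \<in> ?W"
      moreover have "v = w \<circ> Hilbert_Choice.inv \<tau>"
        using that by (simp add: comp_assoc permutes_inv_o)
      ultimately have "v \<in> ?W"
        using PiE_comp_permutes[OF permutes_inv[OF that(2)]] by blast
      then show False using False by simp
    qed
    then have "symmetrize d (A s) \<rho> (v \<circ> \<tau>) = 0" if "\<tau> permutes {..<d}" for \<tau>
      unfolding symmetrize_def using supp that permutes_compose
      by (intro sum.neutral) (auto simp: comp_assoc, blast)
    note this[OF permutes_id] this[OF permutes_swap_id]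
    then show ?thesis using b by simp
  next
    case True
    let ?r = "\<rho>(b := i)"
    have r: "?r \<in> ?W" using \<rho> b i j by (auto simp: PiE_def Pi_def extensional_def j_def)
    have tr: "?r(a := j) = \<rho> \<circ> transpose a b" if "\<rho> a = i" for a
      using that i by (auto simp: fun_eq_iff transpose_def j_def)
    have eq: "symmetrize d (A s) (\<rho> \<circ> transpose a b) v = symmetrize d (A s) \<rho> (v \<circ> transpose a b)"
      if "a < d" for a
      using symmetrize_equivariant[of "transpose a b" d "A s" \<rho> "v \<circ> transpose a b"] that b
      by (simp add: permutes_swap_id comp_assoc)
    have set: "{a. a < d \<and> ?r a = i} = insert b {a. a \<in> {..<d} \<and> \<rho> a = i}"
      using b by auto
    have "0 = (\<Sum>a | a < d \<and> ?r a = i. symmetrize d (A s) (?r(a := j)) v)"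
      by (rule symmetrize_raise[OF inv _ _ True r, symmetric]) (use i j j_def in auto)
    also have "\<dots> = symmetrize d (A s) (?r(b := j)) v
        + (\<Sum>a | a \<in> {..<d} \<and> \<rho> a = i. symmetrize d (A s) (?r(a := j)) v)"
      unfolding set using i by (subst sum.insert) auto
    also have "?r(b := j) = \<rho>" by (auto simp: j_def)
    also have "(\<Sum>a | a \<in> {..<d} \<and> \<rho> a = i. symmetrize d (A s) (?r(a := j)) v)
        = (\<Sum>a | a \<in> {..<d} \<and> \<rho> a = i. symmetrize d (A s) \<rho> (v \<circ> transpose a b))"
      by (rule sum.cong[OF refl]) (use tr eq in auto)
    finally show ?thesis by simp
  qed
qed

text \<open>At the identity matrix only pairs of equal words survive, and each of the
  \<open>fact d\<close> permutations merely relabels the words summed over.\<close>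

lemma sum_symmetrize_diagonal:
  "(\<Sum>\<rho>\<in>{..<d} \<rightarrow>\<^sub>E {..<n}. symmetrize d A \<rho> \<rho>) =
     of_nat (fact d) * tensor_form d n A (\<lambda>x y. if x = y then 1 else 0)"
proof -
  let ?W = "{..<d} \<rightarrow>\<^sub>E {..<n}"
  have W: "\<rho> \<circ> \<tau> \<in> ?W" if "\<tau> permutes {..<d}" "\<rho> \<in> ?W" for \<rho> \<tau>
    using that by (rule PiE_comp_permutes)
  have "(\<Sum>\<rho>\<in>?W. symmetrize d A \<rho> \<rho>) =
      (\<Sum>\<tau> | \<tau> permutes {..<d}. \<Sum>\<rho>\<in>?W. A (\<rho> \<circ> \<tau>) (\<rho> \<circ> \<tau>))"
    unfolding symmetrize_def by (rule sum.swap)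
  also have "\<dots> = (\<Sum>\<tau> | \<tau> permutes {..<d}. \<Sum>\<rho>\<in>?W. A \<rho> \<rho>)"
  proof (rule sum.cong[OF refl])
    fix \<tau> assume \<tau>: "\<tau> \<in> {\<tau>. \<tau> permutes {..<d}}"
    show "(\<Sum>\<rho>\<in>?W. A (\<rho> \<circ> \<tau>) (\<rho> \<circ> \<tau>)) = (\<Sum>\<rho>\<in>?W. A \<rho> \<rho>)"
    proof (rule sum.reindex_bij_witness[of _ "\<lambda>\<rho>. \<rho> \<circ> Hilbert_Choice.inv \<tau>" "\<lambda>\<rho>. \<rho> \<circ> \<tau>"], goal_cases)
      case (2 \<rho>)
      then show ?case using W \<tau> by simp
    next
      case (4 \<rho>)
      then show ?case using W[OF permutes_inv] \<tau> by simp
    qed (use \<tau> in \<open>simp_all add: comp_assoc permutes_inv_o\<close>)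
  qed
  also have "\<dots> = of_nat (fact d) * (\<Sum>\<rho>\<in>?W. A \<rho> \<rho>)"
    by (simp add: card_permutations[of "{..<d}" d])
  also have "(\<Sum>\<rho>\<in>?W. A \<rho> \<rho>) = tensor_form d n A (\<lambda>x y. if x = y then 1 else 0)"
    unfolding tensor_form_def
  proof (rule sum.cong[OF refl])
    fix I assume I: "I \<in> ?W"
    have "(\<Prod>p<d. if I p = J p then 1 else 0) = (if J = I then 1 else 0 :: complex)"
      if J: "J \<in> ?W" for J
    proof (cases "J = I")
      case False
      then obtain p where "p < d" "I p \<noteq> J p" using PiE_ext[OF J I] by fastforce
      then show ?thesis using False by (auto intro!: prod_zero)
    qed simp
    then have "(\<Sum>J\<in>?W. A I J * (\<Prod>p<d. if I p = J p then 1 else 0)) =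
        (\<Sum>J\<in>?W. if J = I then A I J else 0)"
      by (intro sum.cong) auto
    then show "A I I = (\<Sum>J\<in>?W. A I J * (\<Prod>p<d. if I p = J p then 1 else 0))"
      using I by (simp add: finite_PiE)
  qed
  finally show ?thesis .
qed

section \<open>Bracket expansion of invariant functions\<close>

text \<open>
  \<open>None\<close> stands for the constant \<open>1\<close> and pads the monomials to a common degree. For \<open>Some (i,j)\<close>,
  Cramer's rule gives \<open>det(g) (g\<^sup>-\<^sup>1 N g)\<^sub>i\<^sub>j\<close> as the determinant of \<open>g\<close> with column \<open>i\<close> replaced by
  column \<open>j\<close> of \<open>N g\<close>; the functions \<open>factor_letter\<close> and \<open>factor_exponent\<close> describe the columns of
  that matrix.
\<close>

type_synonym factor = "(nat \<times> nat) option"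

fun factor_value :: "factor \<Rightarrow> complex mat \<Rightarrow> complex" where
  "factor_value None N = 1"
| "factor_value (Some ij) N = N $$ ij"

fun factor_letter :: "factor \<Rightarrow> nat \<Rightarrow> nat" where
  "factor_letter None l = l"
| "factor_letter (Some (i,j)) l = (if l = i then j else l)"

fun factor_exponent :: "factor \<Rightarrow> nat \<Rightarrow> nat" where
  "factor_exponent None l = 0"
| "factor_exponent (Some (i,j)) l = (if l = i then 1 else 0)"

definition factors :: "nat \<Rightarrow> factor set" where
  "factors n = insert None (Some ` ({..<n} \<times> {..<n}))"

definition monomials :: "nat \<Rightarrow> nat \<Rightarrow> (complex mat \<Rightarrow> complex) set" where
  "monomials n K = {\<lambda>N. \<Prod>q<K. factor_value (w q) N | w. \<forall>q. w q \<in> factors n}"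

lemma monomials_mono:
  assumes "K \<le> L" shows "monomials n K \<subseteq> monomials n L"
proof
  fix m assume "m \<in> monomials n K"
  then obtain w where w: "\<And>q. w q \<in> factors n" and m: "m = (\<lambda>N. \<Prod>q<K. factor_value (w q) N)"
    by (auto simp: monomials_def)
  have "m = (\<lambda>N. \<Prod>q<L. factor_value (if q < K then w q else None) N)"
    unfolding m by (intro ext prod.mono_neutral_cong_left) (use assms in auto)
  moreover have "\<forall>q. (if q < K then w q else None) \<in> factors n"
    using w by (simp add: factors_def)
  ultimately show "m \<in> monomials n L" unfolding monomials_def by fastforce
qed

lemma monomials_times:
  assumes "m \<in> monomials n K" "m' \<in> monomials n L"
  shows "(\<lambda>N. m N * m' N) \<in> monomials n (K + L)"
proof -
  obtain w where w: "\<And>q. w q \<in> factors n" and m: "m = (\<lambda>N. \<Prod>q<K. factor_value (w q) N)"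
    using assms by (auto simp: monomials_def)
  obtain w' where w': "\<And>q. w' q \<in> factors n" and m': "m' = (\<lambda>N. \<Prod>q<L. factor_value (w' q) N)"
    using assms by (auto simp: monomials_def)
  let ?w = "\<lambda>q. if q < K then w q else w' (q - K)"
  have "(\<Prod>q<L. factor_value (w' q) N) = (\<Prod>q\<in>{K..<K + L}. factor_value (w' (q - K)) N)" for N
    by (rule prod.reindex_bij_witness[of _ "\<lambda>q. q - K" "\<lambda>q. q + K"]) auto
  moreover have "(\<Prod>q<K + L. factor_value (?w q) N) =
      (\<Prod>q<K. factor_value (w q) N) * (\<Prod>q\<in>{K..<K + L}. factor_value (w' (q - K)) N)" for N
  proof -
    have "(\<Prod>q<K + L. factor_value (?w q) N) =
      (\<Prod>q<K. factor_value (?w q) N) * (\<Prod>q\<in>{K..<K + L}. factor_value (?w q) N)"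
      using prod.atLeastLessThan_concat[of 0 K "K + L" "\<lambda>q. factor_value (?w q) N"]
      by (simp only: atLeast0LessThan le0 le_add1 simp_thms)
    also have "\<dots> = (\<Prod>q<K. factor_value (w q) N) * (\<Prod>q\<in>{K..<K + L}. factor_value (w' (q - K)) N)"
      by (intro arg_cong2[where f="(*)"] prod.cong) auto
    finally show ?thesis .
  qed
  ultimately have "(\<lambda>N. m N * m' N) = (\<lambda>N. \<Prod>q<K + L. factor_value (?w q) N)"
    unfolding m m' by simp
  moreover have "\<forall>q. ?w q \<in> factors n" using w w' by simp
  ultimately show ?thesis unfolding monomials_def by fastforce
qed

lemma span_monomials_times:
  assumes p: "p \<in> fun_space.span (monomials n K)" and q: "q \<in> fun_space.span (monomials n L)"
  shows "(\<lambda>N. p N * q N) \<in> fun_space.span (monomials n (K + L))"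
  using p
proof (induction rule: fun_space.span_induct_alt)
  case base
  then show ?case using fun_space.span_zero by (simp add: zero_fun_def)
next
  case (step c x y)
  have "(\<lambda>N. x N * q N) \<in> fun_space.span (monomials n (K + L))"
    using q
  proof (induction rule: fun_space.span_induct_alt)
    case base
    then show ?case using fun_space.span_zero by (simp add: zero_fun_def)
  next
    case (step d u v)
    have "(\<lambda>N. x N * (d * u N + v N)) = (\<lambda>N. d * (x N * u N)) + (\<lambda>N. x N * v N)"
      by (auto simp: fun_eq_iff algebra_simps)
    moreover have "\<dots> \<in> fun_space.span (monomials n (K + L))"
      by (intro fun_space.span_add fun_space.span_scale fun_space.span_base monomials_times
          \<open>x \<in> monomials n K\<close> step)
    ultimately show ?case by (simp add: plus_fun_def)
  qed
  moreover have "(\<lambda>N. (c * x N + y N) * q N) = (\<lambda>N. c * (x N * q N)) + (\<lambda>N. y N * q N)"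
    by (auto simp: fun_eq_iff algebra_simps)
  ultimately show ?case
    using step fun_space.span_add fun_space.span_scale by (simp add: plus_fun_def)
qed

text \<open>\<open>K > 0\<close> is demanded because \<open>K\<close> becomes the number of row
  blocks of a datum, which has at least one.\<close>

lemma polynomial_function_in_span:
  assumes "p \<in> polynomial_functions n"
  shows "\<exists>K>0. p \<in> fun_space.span (monomials n K)"
  using assms
proof induction
  case (const c)
  have "(\<lambda>N. \<Prod>q<1. factor_value None N) \<in> monomials n 1"
    unfolding monomials_def by (auto simp: factors_def intro!: exI[of _ "\<lambda>_. None"])
  then have "(\<lambda>_. c * 1) \<in> fun_space.span (monomials n 1)"
    using fun_space.span_scale[OF fun_space.span_base] by fastforce
  then show ?case by (intro exI[of _ 1]) simp
next
  case (entry i j)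
  have "(\<lambda>N. N $$ (i,j)) \<in> monomials n 1"
    unfolding monomials_def using entry
    by (auto simp: factors_def fun_eq_iff intro!: exI[of _ "\<lambda>_. Some (i,j)"])
  then show ?case by (intro exI[of _ 1]) (auto intro: fun_space.span_base)
next
  case (add p q)
  then obtain K L where KL: "K > 0" "L > 0"
    "p \<in> fun_space.span (monomials n K)" "q \<in> fun_space.span (monomials n L)" by auto
  have "p \<in> fun_space.span (monomials n (max K L))" "q \<in> fun_space.span (monomials n (max K L))"
    using KL fun_space.span_mono[OF monomials_mono] by (meson max.cobounded1 max.cobounded2 subsetD)+
  from fun_space.span_add[OF this] show ?case
    using KL(1) by (intro exI[of _ "max K L"]) (simp add: plus_fun_def)
next
  case (mult p q)
  then obtain K L where KL: "K > 0"
    "p \<in> fun_space.span (monomials n K)" "q \<in> fun_space.span (monomials n L)" by auto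
  then show ?case using span_monomials_times[OF KL(2,3)] by (intro exI[of _ "K + L"]) simp
qed

text \<open>
  The product of \<open>K\<close> brackets is written as one block diagonal determinant of size \<open>K n\<close>, whose
  column \<open>p\<close> is column \<open>I p\<close> of \<open>N\<close> to the power \<open>e p\<close>, placed in block \<open>p div n\<close>.
\<close>

definition bracket :: "nat \<Rightarrow> nat \<Rightarrow> (nat \<Rightarrow> nat) \<Rightarrow> complex mat \<Rightarrow> (nat \<Rightarrow> nat) \<Rightarrow> complex" where
  "bracket n K e N I = det (mat (K * n) (K * n)
     (\<lambda>(r,p). if r div n = p div n then (N ^\<^sub>m e p) $$ (r mod n, I p) else 0))"

definition word_exponents :: "nat \<Rightarrow> (nat \<Rightarrow> factor) \<Rightarrow> nat \<Rightarrow> nat" where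
  "word_exponents n w p = factor_exponent (w (p div n)) (p mod n)"

definition word_letters :: "nat \<Rightarrow> nat \<Rightarrow> (nat \<Rightarrow> factor) \<Rightarrow> nat \<Rightarrow> nat" where
  "word_letters n K w = restrict (\<lambda>p. factor_letter (w (p div n)) (p mod n)) {..<K * n}"

lemma word_letters_PiE:
  assumes "\<And>q. w q \<in> factors n" "n > 0"
  shows "word_letters n K w \<in> {..<K * n} \<rightarrow>\<^sub>E {..<n}"
proof -
  have "factor_letter (w q) l < n" if "l < n" for q l
    using assms(1)[of q] that by (cases "w q") (auto simp: factors_def)
  then show ?thesis using assms(2) by (auto simp: word_letters_def)
qed

lemma det_factor:
  assumes g: "g \<in> carrier_mat n n" and h: "h \<in> carrier_mat n n" and N: "N \<in> carrier_mat n n"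
    and gh: "g * h = 1\<^sub>m n" and w: "w \<in> factors n"
  shows "det (mat n n (\<lambda>(r,l). \<Sum>x<n. g $$ (x, factor_letter w l) * (N ^\<^sub>m factor_exponent w l) $$ (r,x)))
       = det g * factor_value w (h * N * g)"
proof (cases w)
  case None
  have "mat n n (\<lambda>(r,l). \<Sum>x<n. g $$ (x, l) * (1\<^sub>m (dim_row N)) $$ (r,x)) = g"
  proof (rule eq_matI)
    fix r l assume "r < dim_row g" "l < dim_col g"
    then have "r < n" "l < n" using g by auto
    then have "(\<Sum>x<n. g $$ (x, l) * (1\<^sub>m (dim_row N)) $$ (r,x)) = (\<Sum>x<n. if x = r then g $$ (x,l) else 0)"
      using N by (intro sum.cong) auto
    then show "mat n n (\<lambda>(r,l). \<Sum>x<n. g $$ (x, l) * (1\<^sub>m (dim_row N)) $$ (r,x)) $$ (r,l) = g $$ (r,l)"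
      using \<open>r < n\<close> \<open>l < n\<close> by simp
  qed (use g in auto)
  then show ?thesis using None by simp
next
  case (Some ij)
  then obtain i j where ij: "w = Some (i,j)" "i < n" "j < n" using w by (auto simp: factors_def)
  \<comment> \<open>This vector is the solution of the linear system with matrix \<open>g\<close>
    and right-hand side column \<open>j\<close> of \<open>N * g\<close>; Cramer's rule returns its
    entry \<open>i\<close>.\<close>
  define x where "x = col (h * N * g) j"
  have x: "x \<in> carrier_vec n" unfolding x_def by (rule carrier_vecI) (use h in simp)
  have "g *\<^sub>v x = col (g * (h * N * g)) j"
    unfolding x_def using g h N ij by (intro eq_vecI) auto
  also have "g * (h * N * g) = (g * h) * (N * g)"
    using g h N by (simp add: assoc_mult_mat[of _ n n _ n _ n])
  also have "\<dots> = N * g" using gh g N by simp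
  finally have gx: "g *\<^sub>v x = col (N * g) j" .
  have "mat n n (\<lambda>(r,l). \<Sum>x<n. g $$ (x, factor_letter w l) * (N ^\<^sub>m factor_exponent w l) $$ (r,x))
      = replace_col g (g *\<^sub>v x) i" (is "?L = ?R")
  proof (rule eq_matI)
    fix r l assume "r < dim_row ?R" "l < dim_col ?R"
    then have rl: "r < n" "l < n" using g by (auto simp: replace_col_def)
    show "?L $$ (r,l) = ?R $$ (r,l)"
    proof (cases "l = i")
      case True
      then show ?thesis using rl ij g N unfolding gx
        by (auto simp: replace_col_def scalar_prod_def atLeast0LessThan mult.commute intro!: sum.cong)
    next
      case False
      have "(\<Sum>x<n. g $$ (x, l) * (1\<^sub>m (dim_row N)) $$ (r,x)) = (\<Sum>x<n. if x = r then g $$ (x,l) else 0)"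
        using N rl by (intro sum.cong) auto
      then show ?thesis using rl ij g False by (simp add: replace_col_def)
    qed
  qed (use g in \<open>auto simp: replace_col_def\<close>)
  then show ?thesis
    using cramer_lemma_mat[OF g x ij(2)] ij g h N by (simp add: x_def mult.commute)
qed

text \<open>Multilinear expansion read backwards: the sum over \<open>I\<close> assembles column
  \<open>p\<close> from the columns of a power of \<open>N\<close>, with coefficients from the
  column of \<open>g\<close> named by the letter at \<open>p\<close>. The diagonal blocks of the
  result are the matrices of Cramer's rule.\<close>

lemma tensor_form_bracket:
  assumes g: "g \<in> carrier_mat n n" and h: "h \<in> carrier_mat n n" and N: "N \<in> carrier_mat n n"
    and gh: "g * h = 1\<^sub>m n" and w: "\<And>q. w q \<in> factors n" and n: "n > 0"
  shows "tensor_form (K * n) n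
      (\<lambda>I J. if J = word_letters n K w then bracket n K (word_exponents n w) N I else 0) (\<lambda>x y. g $$ (x,y))
    = det g ^ K * (\<Prod>q<K. factor_value (w q) (h * N * g))"
proof -
  let ?d = "K * n" and ?L = "word_letters n K w" and ?e = "word_exponents n w"
  let ?W = "{..<?d} \<rightarrow>\<^sub>E {..<n}"
  define F where "F = (\<lambda>q r l. \<Sum>x<n. g $$ (x, factor_letter (w q) l) *
      (N ^\<^sub>m factor_exponent (w q) l) $$ (r,x))"
  have L: "?L \<in> ?W" by (rule word_letters_PiE[OF w n])
  have "tensor_form ?d n (\<lambda>I J. if J = ?L then bracket n K ?e N I else 0) (\<lambda>x y. g $$ (x,y))
      = (\<Sum>I\<in>?W. \<Sum>J\<in>?W. if J = ?L then (\<Prod>p<?d. g $$ (I p, J p)) * bracket n K ?e N I else 0)"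
    unfolding tensor_form_def by (intro sum.cong refl) auto
  also have "\<dots> = (\<Sum>I\<in>?W. (\<Prod>p<?d. g $$ (I p, ?L p)) * bracket n K ?e N I)"
    using L by (simp add: finite_PiE)
  also have "\<dots> = det (mat ?d ?d (\<lambda>(r,p). \<Sum>x<n. g $$ (x, ?L p) *
       (if r div n = p div n then (N ^\<^sub>m ?e p) $$ (r mod n, x) else 0)))"
    unfolding bracket_def
    by (subst det_sum_columns) (simp_all add: det_scale_columns)
  also have "mat ?d ?d (\<lambda>(r,p). \<Sum>x<n. g $$ (x, ?L p) *
       (if r div n = p div n then (N ^\<^sub>m ?e p) $$ (r mod n, x) else 0)) =
    mat ?d ?d (\<lambda>(r,p). if r div n = p div n then F (p div n) (r mod n) (p mod n) else 0)"
    by (intro eq_matI) (auto simp: word_letters_def word_exponents_def F_def)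
  also have "det \<dots> = (\<Prod>q<K. det (mat n n (\<lambda>(r,c). F q r c)))"
    by (rule det_block_diagonal[OF n])
  also have "\<dots> = (\<Prod>q<K. det g * factor_value (w q) (h * N * g))"
    unfolding F_def by (intro prod.cong refl det_factor[OF g h N gh w])
  finally show ?thesis by (simp add: prod.distrib)
qed

lemma tensor_form_sum:
  "tensor_form d n (\<lambda>I J. \<Sum>a\<in>T. c a * A a I J) g = (\<Sum>a\<in>T. c a * tensor_form d n (A a) g)"
proof -
  have "tensor_form d n (\<lambda>I J. \<Sum>a\<in>T. c a * A a I J) g =
    (\<Sum>I\<in>{..<d} \<rightarrow>\<^sub>E {..<n}. \<Sum>a\<in>T. \<Sum>J\<in>{..<d} \<rightarrow>\<^sub>E {..<n}. c a * (A a I J * (\<Prod>p<d. g (I p) (J p))))"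
    unfolding tensor_form_def sum_distrib_right
    by (rule sum.cong[OF refl], subst sum.swap) (simp add: mult.assoc)
  also have "\<dots> = (\<Sum>a\<in>T. c a * tensor_form d n (A a) g)"
    unfolding tensor_form_def sum_distrib_left by (rule sum.swap)
  finally show ?thesis .
qed

lemma tensor_form_cong:
  assumes "\<And>I J. I \<in> {..<d} \<rightarrow>\<^sub>E {..<n} \<Longrightarrow> J \<in> {..<d} \<rightarrow>\<^sub>E {..<n} \<Longrightarrow> A I J = B I J"
    and "\<And>x y. x < n \<Longrightarrow> y < n \<Longrightarrow> g x y = g' x y"
  shows "tensor_form d n A g = tensor_form d n B g'"
  unfolding tensor_form_def
  by (intro sum.cong refl arg_cong2[where f="(*)"] prod.cong)
     (use assms in \<open>auto simp: PiE_iff\<close>)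

lemma poly_tensor_form:
  "poly (tensor_form d n A g) t = tensor_form d n (\<lambda>I J. poly (A I J) t) (\<lambda>x y. poly (g x y) t)"
  by (simp add: tensor_form_def poly_sum poly_prod)

lemma poly_det_mat:
  "poly (det (mat n n (\<lambda>(x,y). M x y))) t = det (mat n n (\<lambda>(x,y). poly (M x y) t))"
  by (simp add: det_mat_columns poly_sum poly_prod)

text \<open>
  After replacing \<open>g\<close> by \<open>g + t 1\<close> both sides are polynomials in \<open>t\<close>, and the determinant of
  \<open>g + t 1\<close> vanishes for finitely many \<open>t\<close> only.
\<close>

lemma tensor_form_invariant_dense:
  fixes A :: "(nat \<Rightarrow> nat) \<Rightarrow> (nat \<Rightarrow> nat) \<Rightarrow> complex"
  assumes inv: "\<And>g. det (mat n n (\<lambda>(x,y). g x y)) \<noteq> 0 \<Longrightarrow>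
      tensor_form d n A (elementary_action i j z g) = tensor_form d n A g"
  shows "tensor_form d n A (elementary_action i j z g) = tensor_form d n A g"
proof -
  define G :: "nat \<Rightarrow> nat \<Rightarrow> complex poly" where "G = (\<lambda>x y. [:g x y, if x = y then 1 else 0:])"
  define g' where "g' = (\<lambda>t x y. poly (G x y) t)"
  define R where "R = tensor_form d n (\<lambda>I J. [:A I J:]) (elementary_action i j [:z:] G)
      - tensor_form d n (\<lambda>I J. [:A I J:]) G"
  define Q where "Q = det (mat n n (\<lambda>(x,y). G x y))"
  have R: "poly R t = tensor_form d n A (elementary_action i j z (g' t)) - tensor_form d n A (g' t)" for t
  proof -
    have "(\<lambda>x y. poly (elementary_action i j [:z:] G x y) t) = elementary_action i j z (g' t)"
      by (auto simp: elementary_action_def g'_def fun_eq_iff)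
    then show ?thesis by (simp add: R_def poly_tensor_form g'_def)
  qed
  have Q: "poly Q t = det (mat n n (\<lambda>(x,y). g' t x y))" for t
    unfolding Q_def g'_def by (rule poly_det_mat)
  \<comment> \<open>As a polynomial in \<open>t\<close>, \<open>Q\<close> is the characteristic
    polynomial of \<open>- g\<close>, hence monic.\<close>
  let ?m = "mat n n (\<lambda>(x,y). - g x y)"
  have "mat n n (\<lambda>(x,y). G x y) = char_poly_matrix ?m"
    by (rule eq_matI) (auto simp: G_def char_poly_matrix_def)
  then have "Q = char_poly ?m" by (simp add: Q_def char_poly_def)
  then have "Q \<noteq> 0" using degree_monic_char_poly[of ?m n] by auto
  \<comment> \<open>Where \<open>Q\<close> does not vanish, \<open>R\<close> does; since polynomials
    form an integral domain, \<open>R = 0\<close>, in particular at \<open>t = 0\<close>.\<close>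
  moreover have "poly (R * Q) t = 0" for t using inv[of "g' t"] R[of t] Q[of t] by auto
  then have "R * Q = 0" using poly_all_0_iff_0 by blast
  ultimately have "poly R 0 = 0" by simp
  moreover have "g' 0 = g" by (simp add: g'_def G_def)
  ultimately show ?thesis using R[of 0] by simp
qed

text \<open>The guards make the tensor zero off the cone and off the range of words, so that
  invariance holds with every matrix \<open>N\<close> as parameter and the support condition of the
  highest weight argument is met.\<close>

definition bracket_tensor ::
  "nat \<Rightarrow> nat \<Rightarrow> 'a set \<Rightarrow> ('a \<Rightarrow> complex) \<Rightarrow> ('a \<Rightarrow> nat \<Rightarrow> factor) \<Rightarrow>
     complex mat \<Rightarrow> (nat \<Rightarrow> nat) \<Rightarrow> (nat \<Rightarrow> nat) \<Rightarrow> complex" where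
  "bracket_tensor n K T c w N I J =
     (if N \<in> nilpotent_cone n \<and> I \<in> {..<K * n} \<rightarrow>\<^sub>E {..<n} then
        \<Sum>a\<in>T. c a * (if J = word_letters n K (w a) then bracket n K (word_exponents n (w a)) N I else 0)
      else 0)"

section \<open>Conjugation and elementary unipotent matrices\<close>

lemma pow_mat_conjugate:
  fixes g h N :: "complex mat"
  assumes "g \<in> carrier_mat n n" "h \<in> carrier_mat n n" "N \<in> carrier_mat n n" "h * g = 1\<^sub>m n"
  shows "(g * N * h) ^\<^sub>m k * g = g * N ^\<^sub>m k"
proof (induction k)
  case (Suc k)
  have [simp]: "(g * N * h) ^\<^sub>m k \<in> carrier_mat n n" "N ^\<^sub>m k \<in> carrier_mat n n"
    using assms by auto
  have "(g * N * h) ^\<^sub>m Suc k * g = (g * N * h) ^\<^sub>m k * (g * (N * (h * g)))"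
    using assms(1-3) by (simp add: assoc_mult_mat[of _ n n _ n _ n])
  also have "\<dots> = ((g * N * h) ^\<^sub>m k * g) * N"
    unfolding assms(4) using assms(1-3) by (simp add: assoc_mult_mat[of _ n n _ n _ n])
  also have "\<dots> = g * N ^\<^sub>m Suc k"
    unfolding Suc.IH using assms(1-3) by (simp add: assoc_mult_mat[of _ n n _ n _ n])
  finally show ?case .
qed (use assms in auto)

lemma nilpotent_cone_conjugate:
  assumes g: "g \<in> carrier_mat n n" "h \<in> carrier_mat n n" and gh: "g * h = 1\<^sub>m n" "h * g = 1\<^sub>m n"
    and N: "N \<in> nilpotent_cone n"
  shows "g * N * h \<in> nilpotent_cone n"
proof -
  obtain k where k: "N \<in> carrier_mat n n" "N ^\<^sub>m k = 0\<^sub>m n n"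
    using N by (auto simp: nilpotent_cone_def)
  let ?M = "(g * N * h) ^\<^sub>m k"
  have M: "?M \<in> carrier_mat n n" using g k by auto
  have "?M = ?M * (g * h)" unfolding gh using right_mult_one_mat[OF M] by simp
  also have "\<dots> = (?M * g) * h" using M g by (simp add: assoc_mult_mat[of _ n n _ n _ n])
  also have "\<dots> = 0\<^sub>m n n" unfolding pow_mat_conjugate[OF g k(1) gh(2)] k(2) using g by simp
  finally show ?thesis using g k(1) by (auto simp: nilpotent_cone_def)
qed

definition elementary_mat :: "nat \<Rightarrow> nat \<Rightarrow> nat \<Rightarrow> complex \<Rightarrow> complex mat" where
  "elementary_mat n i j z = mat n n (\<lambda>(x,y). (if x = y then 1 else 0) + (if x = i \<and> y = j then z else 0))"

lemma elementary_mat_carrier [simp]: "elementary_mat n i j z \<in> carrier_mat n n"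
  by (simp add: elementary_mat_def)

lemma mult_elementary_mat:
  assumes g: "g \<in> carrier_mat n n" and ij: "i < n" and xy: "x < n" "y < n"
  shows "(g * elementary_mat n i j z) $$ (x,y) = elementary_action i j z (\<lambda>x y. g $$ (x,y)) x y"
proof -
  have "(g * elementary_mat n i j z) $$ (x,y) =
      (\<Sum>k<n. (if k = y then g $$ (x,k) else 0) + (if k = i then (if y = j then z * g $$ (x,k) else 0) else 0))"
    using g xy by (auto simp: elementary_mat_def scalar_prod_def atLeast0LessThan algebra_simps intro!: sum.cong)
  also have "\<dots> = g $$ (x,y) + (if y = j then z * g $$ (x,i) else 0)"
    using xy ij by (simp add: sum.distrib)
  finally show ?thesis by (simp add: elementary_action_def)
qed

lemma elementary_mat_inverse:
  assumes "i < j" "j < n"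
  shows "elementary_mat n i j z * elementary_mat n i j (- z) = 1\<^sub>m n"
proof (rule eq_matI)
  fix x y assume "x < dim_row (1\<^sub>m n :: complex mat)" "y < dim_col (1\<^sub>m n :: complex mat)"
  then show "(elementary_mat n i j z * elementary_mat n i j (- z)) $$ (x,y) = 1\<^sub>m n $$ (x,y)"
    using assms by (subst mult_elementary_mat) (auto simp: elementary_action_def elementary_mat_def)
qed (simp_all add: elementary_mat_def)

lemma elementary_mat_unipotent:
  assumes "i < j" "j < n"
  shows "elementary_mat n i j z \<in> unipotent_group n"
  using assms by (auto simp: unipotent_group_def elementary_mat_def upper_triangular_def)

text \<open>For invertible \<open>g\<close> with inverse \<open>h\<close> the form is
  \<open>det g ^ K * f (h * N * g)\<close>. Right multiplication of \<open>g\<close> by an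
  elementary unipotent matrix changes neither the determinant nor, since \<open>h * N * g\<close>
  stays in the cone, the value of \<open>f\<close>. The identity is needed for all \<open>g\<close>,
  because polarization may evaluate it at singular matrices.\<close>

lemma U_invariant_bracket_tensor:
  assumes n: "n > 0" and f: "f \<in> U_invariants n"
  obtains K T c and w :: "(complex mat \<Rightarrow> complex) \<Rightarrow> nat \<Rightarrow> factor"
  where "K > 0" "finite T" "\<And>a q. a \<in> T \<Longrightarrow> w a q \<in> factors n"
    and "\<And>N i j z g. i < j \<Longrightarrow> j < n \<Longrightarrow>
      tensor_form (K * n) n (bracket_tensor n K T c w N) (elementary_action i j z g) =
      tensor_form (K * n) n (bracket_tensor n K T c w N) g"
    and "\<And>N. N \<in> nilpotent_cone n \<Longrightarrow>
      tensor_form (K * n) n (bracket_tensor n K T c w N) (\<lambda>x y. if x = y then 1 else 0) = f N"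
proof -
  let ?X = "nilpotent_cone n"
  obtain p where p: "p \<in> polynomial_functions n" "\<And>N. N \<in> ?X \<Longrightarrow> f N = p N"
    using f by (auto simp: U_invariants_def regular_functions_def)
  obtain K where K: "K > 0" "p \<in> fun_space.span (monomials n K)"
    using polynomial_function_in_span[OF p(1)] by auto
  obtain T c where T: "finite T" "T \<subseteq> monomials n K" and pT: "p = (\<Sum>a\<in>T. (\<lambda>N. c a * a N))"
    using K(2) unfolding fun_space.span_explicit by auto
  have "\<forall>a\<in>T. \<exists>w. (\<forall>q. w q \<in> factors n) \<and> a = (\<lambda>N. \<Prod>q<K. factor_value (w q) N)"
    using T(2) by (auto simp: monomials_def)
  from bchoice[OF this] obtain w where
    w': "\<And>a. a \<in> T \<Longrightarrow> (\<forall>q. w a q \<in> factors n) \<and> a = (\<lambda>N. \<Prod>q<K. factor_value (w a q) N)"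
    by blast
  have w: "w a q \<in> factors n" if "a \<in> T" for a q
    using w'[OF that] by blast
  have w2: "a N = (\<Prod>q<K. factor_value (w a q) N)" if "a \<in> T" for a N
    using arg_cong[OF conjunct2[OF w'[OF that]], of "\<lambda>a. a N"] .
  have sum_app: "(\<Sum>a\<in>S. F a) N = (\<Sum>a\<in>S. F a N)"
    for S :: "(complex mat \<Rightarrow> complex) set" and F :: "_ \<Rightarrow> complex mat \<Rightarrow> complex" and N
    by (induction S rule: infinite_finite_induct) simp_all
  let ?A = "bracket_tensor n K T c w" and ?d = "K * n"
  have val: "tensor_form ?d n (?A N) (\<lambda>x y. g $$ (x,y)) = det g ^ K * f (h * N * g)"
    if g: "g \<in> carrier_mat n n" "h \<in> carrier_mat n n" "g * h = 1\<^sub>m n" "h * g = 1\<^sub>m n" and N: "N \<in> ?X"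
    for g h N
  proof -
    have Nc: "N \<in> carrier_mat n n" using N by (simp add: nilpotent_cone_def)
    have "tensor_form ?d n (?A N) (\<lambda>x y. g $$ (x,y)) = tensor_form ?d n (\<lambda>I J. \<Sum>a\<in>T. c a *
        (if J = word_letters n K (w a) then bracket n K (word_exponents n (w a)) N I else 0)) (\<lambda>x y. g $$ (x,y))"
      by (rule tensor_form_cong) (simp_all add: bracket_tensor_def N)
    also have "\<dots> = (\<Sum>a\<in>T. c a * (det g ^ K * (\<Prod>q<K. factor_value (w a q) (h * N * g))))"
      unfolding tensor_form_sum
      by (intro sum.cong refl arg_cong2[where f="(*)"] tensor_form_bracket g Nc n w)
    also have "\<dots> = det g ^ K * p (h * N * g)"
      unfolding pT sum_app by (simp add: w2 sum_distrib_left mult.left_commute)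
    also have "p (h * N * g) = f (h * N * g)"
      using p(2) nilpotent_cone_conjugate[OF g(2,1,4,3) N] by simp
    finally show ?thesis .
  qed
  show ?thesis
  proof (rule that[OF K(1) T(1) w])
    fix N i j z g assume ij: "i < j" "j < n"
    show "tensor_form ?d n (?A N) (elementary_action i j z g) = tensor_form ?d n (?A N) g"
    proof (cases "N \<in> ?X")
      case False
      then show ?thesis by (simp add: tensor_form_def bracket_tensor_def)
    next
      case N: True
      show ?thesis
      proof (rule tensor_form_invariant_dense)
        fix g :: "nat \<Rightarrow> nat \<Rightarrow> complex"
        define m where "m = mat n n (\<lambda>(x,y). g x y)"
        assume "det (mat n n (\<lambda>(x,y). g x y)) \<noteq> 0"
        then have "det m \<noteq> 0" and mc: "m \<in> carrier_mat n n" by (simp_all add: m_def)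
        from det_non_zero_imp_unit[OF mc this(1)] obtain h where
          h: "h \<in> carrier_mat n n" "m * h = 1\<^sub>m n" "h * m = 1\<^sub>m n"
          by (auto simp: Units_def ring_mat_def)
        let ?u = "elementary_mat n i j z" and ?u' = "elementary_mat n i j (- z)"
        have uu: "?u * ?u' = 1\<^sub>m n" "?u' * ?u = 1\<^sub>m n"
          using elementary_mat_inverse[OF ij, of z] elementary_mat_inverse[OF ij, of "- z"] by simp_all
        have u'h: "?u' * h \<in> carrier_mat n n" "m * ?u \<in> carrier_mat n n"
          using mc h(1) by (intro mult_carrier_mat[of _ n n _ n]; simp)+
        have inv1: "(m * ?u) * (?u' * h) = 1\<^sub>m n"
        proof -
          have "(m * ?u) * (?u' * h) = m * ((?u * ?u') * h)"
            using mc h(1) u'h by (simp add: assoc_mult_mat[of _ n n _ n _ n])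
          then show ?thesis unfolding uu using h by simp
        qed
        have inv2: "(?u' * h) * (m * ?u) = 1\<^sub>m n"
        proof -
          have "(?u' * h) * (m * ?u) = ?u' * ((h * m) * ?u)"
            using mc h(1) u'h by (simp add: assoc_mult_mat[of _ n n _ n _ n])
          then show ?thesis unfolding h using uu left_mult_one_mat[of ?u n n] by simp
        qed
        have Nc: "N \<in> carrier_mat n n" using N by (simp add: nilpotent_cone_def)
        have "dim_row ?u = n" by (simp add: elementary_mat_def)
        then have detu: "det ?u = 1"
          using elementary_mat_unipotent[OF ij, of z]
          by (subst det_upper_triangular[of _ n]) (auto simp: unipotent_group_def diag_mat_def intro!: prod_list_neutral)
        have "tensor_form ?d n (?A N) (elementary_action i j z g)
            = tensor_form ?d n (?A N) (\<lambda>x y. (m * ?u) $$ (x,y))"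
          by (rule tensor_form_cong[OF refl], subst mult_elementary_mat[OF mc])
             (use ij in \<open>auto simp: m_def elementary_action_def\<close>)
        also have "\<dots> = det (m * ?u) ^ K * f ((?u' * h) * N * (m * ?u))"
          by (rule val[OF u'h(2,1) inv1 inv2 N])
        also have "(?u' * h) * N * (m * ?u) = ?u' * (h * N * m) * ?u"
          using mc h(1) Nc by (simp add: assoc_mult_mat[of _ n n _ n _ n])
        \<comment> \<open>Invariance is applied to the group element \<open>?u'\<close>, whose
          inverse is \<open>?u\<close>.\<close>
        also have "f \<dots> = f (h * N * m)"
          using f elementary_mat_unipotent[OF ij, of "- z"] uu nilpotent_cone_conjugate[OF h(1) mc h(3,2) N]
          by (auto simp: U_invariants_def inverts_mat_def elementary_mat_def)
        also have "det (m * ?u) = det m" using det_mult[OF mc, of ?u] detu by simp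
        also have "det m ^ K * f (h * N * m) = tensor_form ?d n (?A N) (\<lambda>x y. m $$ (x,y))"
          by (rule val[OF mc h N, symmetric])
        also have "\<dots> = tensor_form ?d n (?A N) g"
          by (rule tensor_form_cong) (simp_all add: m_def)
        finally show "tensor_form ?d n (?A N) (elementary_action i j z g) = tensor_form ?d n (?A N) g" .
      qed
    qed
  next
    fix N assume N: "N \<in> ?X"
    then have Nc: "N \<in> carrier_mat n n" by (simp add: nilpotent_cone_def)
    have "tensor_form ?d n (?A N) (\<lambda>x y. if x = y then 1 else 0) = tensor_form ?d n (?A N) (\<lambda>x y. 1\<^sub>m n $$ (x,y))"
      by (rule tensor_form_cong) auto
    also have "\<dots> = f N" using val[of "1\<^sub>m n" "1\<^sub>m n" N] N Nc by simp
    finally show "tensor_form ?d n (?A N) (\<lambda>x y. if x = y then 1 else 0) = f N" .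
  qed
qed

section \<open>Brackets as combinations of datum functions\<close>

lemma block_pos_bounds:
  "q < sum_list bs \<Longrightarrow> block_pos bs q = (j,l) \<Longrightarrow> j < length bs \<and> l < bs ! j"
proof (induction bs arbitrary: q j)
  case (Cons b bs)
  show ?case
  proof (cases "q < b")
    case False
    then obtain j' where j': "block_pos bs (q - b) = (j',l)" "j = Suc j'"
      using Cons.prems(2) by (auto split: prod.splits)
    then show ?thesis using Cons.IH[of "q - b" j'] Cons.prems(1) False by simp
  qed (use Cons.prems in auto)
qed simp

lemma block_pos_less:
  "q < p \<Longrightarrow> p < sum_list bs \<Longrightarrow> block_pos bs p = (i,k) \<Longrightarrow> block_pos bs q = (i,l) \<Longrightarrow> l < k"
proof (induction bs arbitrary: p q i)
  case (Cons b bs)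
  show ?case
  proof (cases "p < b")
    case False
    then obtain i' where i': "block_pos bs (p - b) = (i',k)" "i = Suc i'"
      using Cons.prems(3) by (auto split: prod.splits)
    then have "\<not> q < b" using Cons.prems(4) by auto
    moreover from this have "block_pos bs (q - b) = (i',l)"
      using Cons.prems(4) i' by (auto split: prod.splits)
    ultimately show ?thesis
      using Cons.IH[of "q - b" "p - b" i'] Cons.prems(1,2) i' False by simp
  qed (use Cons.prems in auto)
qed simp

lemma sum_block_pos:
  fixes \<phi> :: "nat \<Rightarrow> nat \<Rightarrow> 'a::comm_monoid_add"
  shows "(\<Sum>q<sum_list bs. case block_pos bs q of (j,l) \<Rightarrow> \<phi> j l) = (\<Sum>j<length bs. \<Sum>l<bs ! j. \<phi> j l)"
proof (induction bs arbitrary: \<phi>)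
  case (Cons b bs)
  have "(\<Sum>q<sum_list (b # bs). case block_pos (b # bs) q of (j,l) \<Rightarrow> \<phi> j l)
      = (\<Sum>q<b. case block_pos (b # bs) q of (j,l) \<Rightarrow> \<phi> j l)
      + (\<Sum>q\<in>{b..<b + sum_list bs}. case block_pos (b # bs) q of (j,l) \<Rightarrow> \<phi> j l)"
    using sum.atLeastLessThan_concat[of 0 b "b + sum_list bs" "\<lambda>q. case block_pos (b # bs) q of (j,l) \<Rightarrow> \<phi> j l"]
    by (simp only: atLeast0LessThan le0 le_add1 simp_thms sum_list.Cons)
  also have "(\<Sum>q<b. case block_pos (b # bs) q of (j,l) \<Rightarrow> \<phi> j l) = (\<Sum>l<b. \<phi> 0 l)"
    by (rule sum.cong) auto
  also have "(\<Sum>q\<in>{b..<b + sum_list bs}. case block_pos (b # bs) q of (j,l) \<Rightarrow> \<phi> j l)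
      = (\<Sum>q<sum_list bs. case block_pos bs q of (j,l) \<Rightarrow> \<phi> (Suc j) l)"
    by (rule sum.reindex_bij_witness[of _ "\<lambda>q. q + b" "\<lambda>q. q - b"]) (auto split: prod.splits)
  also have "\<dots> = (\<Sum>j<length bs. \<Sum>l<bs ! j. \<phi> (Suc j) l)" by (rule Cons.IH)
  also have "(\<Sum>l<b. \<phi> 0 l) + (\<Sum>j<length bs. \<Sum>l<bs ! j. \<phi> (Suc j) l)
      = (\<Sum>j<length (b # bs). \<Sum>l<(b # bs) ! j. \<phi> j l)"
    by (simp add: sum.lessThan_Suc_shift del: sum.lessThan_Suc)
  finally show ?case .
qed simp

lemma block_pos_replicate:
  assumes "n > 0"
  shows "q < K * n \<Longrightarrow> block_pos (replicate K n) q = (q div n, q mod n)"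
proof (induction K arbitrary: q)
  case (Suc K)
  show ?case
  proof (cases "q < n")
    case False
    then have "block_pos (replicate K n) (q - n) = ((q - n) div n, (q - n) mod n)"
      using Suc by simp
    then show ?thesis using False assms by (simp add: le_div_geq le_mod_geq)
  qed simp
qed simp

lemma block_pos_concat:
  "c < length (concat pss) \<Longrightarrow> block_pos (map length pss) c = (r,l) \<Longrightarrow>
    r < length pss \<and> l < length (pss ! r) \<and> concat pss ! c = pss ! r ! l"
proof (induction pss arbitrary: c r)
  case (Cons ps pss)
  show ?case
  proof (cases "c < length ps")
    case False
    then obtain r' where r': "block_pos (map length pss) (c - length ps) = (r',l)" "r = Suc r'"
      using Cons.prems(2) by (auto split: prod.splits)
    then show ?thesis using Cons.IH[of "c - length ps" r'] Cons.prems(1) False by (simp add: nth_append)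
  qed (use Cons.prems in \<open>auto simp: nth_append\<close>)
qed simp

text \<open>The diagonal blocks are principal blocks of \<open>g\<close> starting at
  \<open>off i\<close>. Lower right corners of \<open>g\<close> (acting on the rows of a datum
  matrix) and upper left corners (acting on its columns) both occur.\<close>

lemma det_block_unipotent:
  assumes g: "g \<in> unipotent_group n" and off: "\<And>i. i < length as \<Longrightarrow> off i + as ! i \<le> n"
  shows "det (mat (sum_list as) (sum_list as) (\<lambda>(p,q). case (block_pos as p, block_pos as q) of
     ((i,k), (j,l)) \<Rightarrow> if i = j then g $$ (off i + k, off i + l) else 0)) = 1" (is "det ?G = 1")
proof -
  have G: "?G \<in> carrier_mat (sum_list as) (sum_list as)" by simp
  have "upper_triangular ?G"
  proof
    fix p q assume qp: "q < p" and "p < dim_row ?G"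
    then have p: "p < sum_list as" by simp
    obtain i k j l where bp: "block_pos as p = (i,k)" "block_pos as q = (j,l)" by fastforce
    show "?G $$ (p,q) = 0"
    proof (cases "i = j")
      case True
      then have lk: "l < k" using block_pos_less[OF qp p bp(1)] bp(2) by simp
      have "i < length as" "k < as ! i" using block_pos_bounds[OF p bp(1)] by auto
      then have "off i + k < n" using off[of i] by simp
      then show ?thesis using g lk True bp p qp
        by (auto simp: unipotent_group_def upper_triangular_def)
    qed (use bp p qp in simp)
  qed
  from det_upper_triangular[OF this G] have "det ?G = prod_list (diag_mat ?G)" .
  also have "\<dots> = 1"
  proof (rule prod_list_neutral)
    fix x assume "x \<in> set (diag_mat ?G)"
    then obtain p where p: "p < sum_list as" "x = ?G $$ (p,p)" by (auto simp: diag_mat_def)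
    obtain i k where bp: "block_pos as p = (i,k)" by fastforce
    have "off i + k < n" using block_pos_bounds[OF p(1) bp] off[of i] by auto
    then show "x = 1" using p bp g by (simp add: unipotent_group_def)
  qed
  finally show ?thesis .
qed

lemma mat_poly_carrier [simp]: "N \<in> carrier_mat n n \<Longrightarrow> mat_poly p N \<in> carrier_mat n n"
  by (simp add: mat_poly_def)

lemma mat_poly_bound:
  assumes "N \<in> carrier_mat n n" "x < n" "y < n" "degree p \<le> m"
  shows "mat_poly p N $$ (x,y) = (\<Sum>k\<le>m. coeff p k * (N ^\<^sub>m k) $$ (x,y))"
proof -
  have "(\<Sum>k\<le>degree p. coeff p k * (N ^\<^sub>m k) $$ (x,y)) = (\<Sum>k\<le>m. coeff p k * (N ^\<^sub>m k) $$ (x,y))"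
    by (rule sum.mono_neutral_left) (use assms in \<open>auto simp: coeff_eq_0\<close>)
  then show ?thesis using assms by (simp add: mat_poly_def)
qed

text \<open>This keeps subset sums within datum matrices: the powers attached to the positions in
  \<open>S\<close> add up to a single polynomial in \<open>N\<close>.\<close>

lemma mat_poly_sum_monom:
  assumes N: "N \<in> carrier_mat n n" "x < n" "y < n" and S: "finite S"
  shows "mat_poly (\<Sum>p\<in>S. monom 1 (e p)) N $$ (x,y) = (\<Sum>p\<in>S. (N ^\<^sub>m e p) $$ (x,y))"
proof -
  \<comment> \<open>A common degree bound; inserting \<open>0\<close> covers the empty
    \<open>S\<close>.\<close>
  define m where "m = Max (insert 0 (e ` S))"
  have e: "e p \<le> m" if "p \<in> S" for p unfolding m_def using S that by simp
  have "degree (\<Sum>p\<in>S. monom (1::complex) (e p)) \<le> m"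
    by (rule degree_sum_le[OF S]) (use e degree_monom_le order_trans in blast)
  then have "mat_poly (\<Sum>p\<in>S. monom 1 (e p)) N $$ (x,y)
      = (\<Sum>k\<le>m. \<Sum>p\<in>S. if k = e p then (N ^\<^sub>m k) $$ (x,y) else 0)"
    by (subst mat_poly_bound[OF N]) (auto simp: coeff_sum sum_distrib_right intro!: sum.cong)
  also have "\<dots> = (\<Sum>p\<in>S. \<Sum>k\<le>m. if k = e p then (N ^\<^sub>m k) $$ (x,y) else 0)" by (rule sum.swap)
  also have "\<dots> = (\<Sum>p\<in>S. (N ^\<^sub>m e p) $$ (x,y))"
    by (rule sum.cong) (use e in auto)
  finally show ?thesis .
qed

lemma corner_index:
  assumes "M \<in> carrier_mat n n" "a \<le> n" "b \<le> n" "k < a" "l < b"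
  shows "corner M a b $$ (k,l) = M $$ (n - a + k, l)"
  using assms by (subst corner_alt) auto

lemma datum_mat_index:
  assumes N: "N \<in> carrier_mat n n" and dat: "is_datum n as bs P"
    and pq: "p < sum_list as" "q < sum_list bs"
    and bp: "block_pos as p = (i,k)" "block_pos bs q = (j,l)"
  shows "datum_mat as bs P N $$ (p,q) = mat_poly (P i j) N $$ (n - as ! i + k, l)"
proof -
  have "i < length as" "k < as ! i" "j < length bs" "l < bs ! j"
    using block_pos_bounds[OF pq(1) bp(1)] block_pos_bounds[OF pq(2) bp(2)] by auto
  moreover from this have "as ! i \<in> {1..n}" "bs ! j \<in> {1..n}"
    using dat unfolding is_datum_def by (meson nth_mem subsetD)+
  ultimately show ?thesis
    using pq bp N by (simp add: datum_mat_def block_mat_def corner_index[of _ n])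
qed

text \<open>Rearranging the bracket columns by
  \<open>\<pi> = inv \<tau> \<circ> inv \<gamma> \<circ> \<beta>\<close> sorts them by tableau
  column: column \<open>c\<close> comes from position \<open>\<pi> c\<close> and has letter
  \<open>\<rho> (\<beta> c)\<close>, whatever \<open>\<gamma>\<close> is. Only the exponent and the
  row block depend on \<open>\<pi> c\<close>. The alternating sum is then, up to sign, a mixed
  discriminant, once permutations outside the column group are made to contribute zero.\<close>

lemma alternating_bracket_in_span:
  assumes n: "n > 0" and K: "K > 0" and d: "d = K * n"
    and pss: "[] \<notin> set pss" "distinct (concat pss)" "set (concat pss) = {..<d}"
      "\<And>ps. ps \<in> set pss \<Longrightarrow> map \<rho> ps = [0..<length ps]"
    and \<rho>: "\<And>p. p < d \<Longrightarrow> \<rho> p < n" and \<tau>: "\<tau> permutes {..<d}"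
  shows "(\<lambda>N. if N \<in> nilpotent_cone n
      then \<Sum>\<gamma>\<in>column_group pss. of_int (sign \<gamma>) * bracket n K e N (\<rho> \<circ> \<gamma> \<circ> \<tau>) else 0)
    \<in> fun_space.span {datum_fun n as bs P | as bs P. is_datum n as bs P}"
proof -
  define bs where "bs = map length pss"
  define as where "as = replicate K n"
  have len: "length (concat pss) = d" using distinct_card[OF pss(2)] pss(3) by simp
  then have sbs: "sum_list bs = d" by (simp add: bs_def length_concat)
  have sas: "sum_list as = d" by (simp add: as_def d sum_list_replicate)
  \<comment> \<open>\<open>\<beta>\<close> reads the tableau column by column, sending a matrix
    column to a position.\<close>
  define \<beta> where "\<beta> = (\<lambda>c. if c < d then concat pss ! c else c)"
  have \<beta>: "\<beta> permutes {..<d}"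
  proof (rule bij_imp_permutes)
    have "bij_betw (\<lambda>c. concat pss ! c) {..<d} {..<d}"
      using bij_betw_nth[OF pss(2), of "{..<d}"] len pss(3) by simp
    then show "bij_betw \<beta> {..<d} {..<d}" by (rule bij_betw_cong[THEN iffD1, rotated]) (simp add: \<beta>_def)
  qed (simp add: \<beta>_def)
  \<comment> \<open>The number of the tableau column that contains \<open>x\<close>.\<close>
  define col where "col = (\<lambda>x. fst (block_pos bs (Hilbert_Choice.inv \<beta> x)))"
  have col\<beta>: "col (\<beta> c) = fst (block_pos bs c)" for c
    using \<beta> by (simp add: col_def permutes_inverses)
  have pos: "r < length pss \<and> l < length (pss ! r) \<and> \<beta> c = pss ! r ! l \<and> \<rho> (\<beta> c) = l"
    if "c < d" "block_pos bs c = (r,l)" for c r l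
  proof -
    have *: "r < length pss" "l < length (pss ! r)" "concat pss ! c = pss ! r ! l"
      using block_pos_concat[of c pss r l] that len by (auto simp: bs_def)
    then have "map \<rho> (pss ! r) ! l = [0..<length (pss ! r)] ! l" using pss(4)[of "pss ! r"] by simp
    then show ?thesis using * that by (simp add: \<beta>_def)
  qed
  have in_col: "x \<in> set (pss ! r) \<longleftrightarrow> x < d \<and> col x = r" if r: "r < length pss" for x r
  proof
    assume "x \<in> set (pss ! r)"
    then obtain l where l: "l < length (pss ! r)" "x = pss ! r ! l" by (auto simp: in_set_conv_nth)
    define c where "c = sum_list (take r bs) + l"
    have c: "block_pos bs c = (r,l)" "c < d"
      unfolding c_def sbs[symmetric]
      by (rule block_pos_eq block_index_less; use r l in \<open>simp add: bs_def\<close>)+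
    then have "x = \<beta> c" using pos[OF c(2,1)] l by simp
    then show "x < d \<and> col x = r"
      using c \<beta> permutes_in_image[OF \<beta>, of c] col\<beta> by simp
  next
    assume x: "x < d \<and> col x = r"
    define c where "c = Hilbert_Choice.inv \<beta> x"
    have c: "\<beta> c = x" "c < d"
      using \<beta> x permutes_in_image[OF permutes_inv[OF \<beta>], of x] by (simp_all add: c_def permutes_inverses)
    obtain r' l where bp: "block_pos bs c = (r',l)" by fastforce
    then have "r' = r" using x col\<beta>[of c] c by simp
    then show "x \<in> set (pss ! r)" using pos[OF c(2) bp] c by simp
  qed
  have cg: "column_group pss = {\<gamma>. \<gamma> permutes {..<d} \<and> (\<forall>x<d. col (\<gamma> x) = col x)}"
  proof (intro Set.set_eqI iffI)
    fix \<gamma> assume \<gamma>: "\<gamma> \<in> column_group pss"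
    then have perm: "\<gamma> permutes {..<d}" unfolding column_group_def pss(3) by simp
    have "col (\<gamma> x) = col x" if "x < d" for x
    proof -
      have "x \<in> set (concat pss)" using that pss(3) by simp
      then obtain r where r: "r < length pss" "x \<in> set (pss ! r)"
        by (auto simp: in_set_conv_nth[of _ pss])
      then have "\<gamma> x \<in> set (pss ! r)" using \<gamma> unfolding column_group_def by auto
      then show ?thesis using in_col[OF r(1)] r(2) by simp
    qed
    with perm show "\<gamma> \<in> {\<gamma>. \<gamma> permutes {..<d} \<and> (\<forall>x<d. col (\<gamma> x) = col x)}" by simp
  next
    fix \<gamma> assume \<gamma>: "\<gamma> \<in> {\<gamma>. \<gamma> permutes {..<d} \<and> (\<forall>x<d. col (\<gamma> x) = col x)}"
    have "\<gamma> x \<in> set ps" if ps: "ps \<in> set pss" and x: "x \<in> set ps" for ps x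
    proof -
      obtain r where r: "r < length pss" "ps = pss ! r" using ps by (auto simp: in_set_conv_nth)
      then have "x < d" "col x = r" using in_col[OF r(1)] x by simp_all
      then show ?thesis using in_col[OF r(1)] r(2) \<gamma> permutes_in_image[of \<gamma> "{..<d}" x] by simp
    qed
    then show "\<gamma> \<in> column_group pss" using \<gamma> unfolding column_group_def pss(3) by simp
  qed
  \<comment> \<open>Position \<open>p\<close> adds a monomial to the block whose row number is its
    bracket \<open>p div n\<close> and whose column number is the tableau column of
    \<open>\<tau> p\<close>.\<close>
  define P where "P = (\<lambda>S i j. \<Sum>p | p \<in> S \<and> p div n = i \<and> col (\<tau> p) = j. monom (1::complex) (e p))"
  have "d > 0" using n K d by simp
  have dat: "is_datum n as bs (P S)" for S
  proof -
    have "length ps \<in> {1..n}" if "ps \<in> set pss" for ps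
    proof -
      have ne: "ps \<noteq> []" using that pss(1) by auto
      then have "map \<rho> ps ! (length ps - 1) = length ps - 1" using pss(4)[OF that] by simp
      \<comment> \<open>The lowest position of a tableau column has the letter
        \<open>length ps - 1\<close>; letters are below \<open>n\<close>, which bounds the width of
        the block.\<close>
      then have "\<rho> (last ps) = length ps - 1" using ne by (simp add: last_conv_nth)
      moreover have "last ps \<in> set (concat pss)" using last_in_set[OF ne] that by auto
      then have "last ps < d" unfolding pss(3) by simp
      ultimately have "length ps - 1 < n" using \<rho>[of "last ps"] by simp
      then show ?thesis using ne by (cases ps) auto
    qed
    then show ?thesis using \<open>d > 0\<close> sbs sas K n
      by (auto simp: is_datum_def as_def bs_def)
  qed
  \<comment> \<open>The contribution of position \<open>p\<close>: in the rows of its bracket and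
    the columns of its tableau column stand the first columns of \<open>N ^\<^sub>m e p\<close>,
    since \<open>\<rho> (\<beta> c)\<close> is the place of \<open>c\<close> within its block. The
    condition on \<open>col\<close> eliminates permutations outside the column group.\<close>
  define M where "M = (\<lambda>N p r c. if r div n = p div n \<and> col (\<tau> p) = col (\<beta> c)
      then (N ^\<^sub>m e p) $$ (r mod n, \<rho> (\<beta> c)) else (0::complex))"
  have dm: "datum_mat as bs (P S) N = mat d d (\<lambda>(r,c). \<Sum>p\<in>S. M N p r c)"
    if N: "N \<in> carrier_mat n n" and S: "S \<subseteq> {..<d}" for N S
  proof (rule eq_matI)
    fix r c assume "r < dim_row (mat d d (\<lambda>(r,c). \<Sum>p\<in>S. M N p r c))"
      "c < dim_col (mat d d (\<lambda>(r,c). \<Sum>p\<in>S. M N p r c))"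
    then have rc: "r < d" "c < d" by simp_all
    have finS: "finite S" using S finite_subset by blast
    obtain j l where jl: "block_pos bs c = (j,l)" by fastforce
    have j: "col (\<beta> c) = j" "\<rho> (\<beta> c) = l" using col\<beta>[of c] jl pos[OF rc(2) jl] by (simp, blast)
    have l: "l < n" using j \<rho>[of "\<beta> c"] permutes_in_image[OF \<beta>, of c] rc by simp
    have ri: "block_pos as r = (r div n, r mod n)"
      unfolding as_def using block_pos_replicate[OF n] rc d by simp
    have "r div n < K" using rc d by (simp add: less_mult_imp_div_less)
    \<comment> \<open>Every row block has full height \<open>n\<close>, so its corner starts at row
      \<open>0\<close>.\<close>
    then have "n - as ! (r div n) + r mod n = r mod n" by (simp add: as_def)
    then have "datum_mat as bs (P S) N $$ (r,c) = mat_poly (P S (r div n) j) N $$ (r mod n, l)"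
      using datum_mat_index[OF N dat _ _ ri jl] rc sas sbs by simp
    also have "\<dots> = (\<Sum>p | p \<in> S \<and> p div n = r div n \<and> col (\<tau> p) = j. (N ^\<^sub>m e p) $$ (r mod n, l))"
      unfolding P_def by (rule mat_poly_sum_monom[OF N _ l]) (use n finS in auto)
    also have "\<dots> = (\<Sum>p\<in>S. M N p r c)"
      unfolding M_def j using finS by (simp add: sum.inter_filter[symmetric] eq_commute)
    finally show "datum_mat as bs (P S) N $$ (r,c) = mat d d (\<lambda>(r,c). \<Sum>p\<in>S. M N p r c) $$ (r,c)"
      using rc by simp
  qed (simp_all add: datum_mat_def block_mat_def sas sbs)
  let ?inv = "Hilbert_Choice.inv"
  have term_eq: "det (mat d d (\<lambda>(r,c). M N ((?inv \<tau> \<circ> ?inv \<gamma> \<circ> \<beta>) c) r c)) =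
      (if \<gamma> \<in> column_group pss then of_int (sign \<beta> * sign \<tau>) *
         (of_int (sign \<gamma>) * bracket n K e N (\<rho> \<circ> \<gamma> \<circ> \<tau>)) else 0)"
    if \<gamma>: "\<gamma> permutes {..<d}" for \<gamma> N
  proof (cases "\<gamma> \<in> column_group pss")
    case True
    define \<pi> where "\<pi> = ?inv \<tau> \<circ> ?inv \<gamma> \<circ> \<beta>"
    have \<pi>: "\<pi> permutes {..<d}" unfolding \<pi>_def
      by (intro permutes_compose permutes_inv \<tau> \<gamma> \<beta>)
    have \<tau>\<pi>: "\<tau> (\<pi> c) = ?inv \<gamma> (\<beta> c)" for c using \<tau> by (simp add: \<pi>_def permutes_inverses)
    have \<gamma>\<tau>\<pi>: "\<gamma> (\<tau> (\<pi> c)) = \<beta> c" for c unfolding \<tau>\<pi> using \<gamma> by (simp add: permutes_inverses)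
    have col: "col (\<tau> (\<pi> c)) = col (\<beta> c)" if "c < d" for c
    proof -
      have "\<tau> (\<pi> c) < d" using that permutes_in_image[OF \<tau>, of "\<pi> c"] permutes_in_image[OF \<pi>, of c] by simp
      then show ?thesis using True unfolding cg \<gamma>\<tau>\<pi>[symmetric] by simp
    qed
    have "mat d d (\<lambda>(r,c). M N (\<pi> c) r c) = mat d d (\<lambda>(r,c).
        (\<lambda>r p. if r div n = p div n then (N ^\<^sub>m e p) $$ (r mod n, (\<rho> \<circ> \<gamma> \<circ> \<tau>) p) else 0) r (\<pi> c))"
      by (rule eq_matI) (simp_all add: M_def col \<gamma>\<tau>\<pi>)
    then have "det (mat d d (\<lambda>(r,c). M N (\<pi> c) r c)) = of_int (sign \<pi>) * bracket n K e N (\<rho> \<circ> \<gamma> \<circ> \<tau>)"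
      unfolding bracket_def d[symmetric] using det_permute_columns[OF \<pi>] by simp
    moreover have "permutation \<beta>" "permutation (?inv \<tau>)" "permutation (?inv \<gamma>)" "permutation \<tau>" "permutation \<gamma>"
      using \<beta> \<tau> \<gamma> permutes_inv permutation_permutes by blast+
    then have "sign \<pi> = sign \<beta> * sign \<tau> * sign \<gamma>"
      unfolding \<pi>_def by (simp add: sign_compose permutation_compose sign_inverse)
    ultimately show ?thesis using True by (simp add: \<pi>_def mult.assoc)
  next
    case False
    then obtain x where x: "x < d" "col (\<gamma> x) \<noteq> col x" using \<gamma> unfolding cg by auto
    \<comment> \<open>Column \<open>c\<close> of the matrix vanishes, because its position
      \<open>inv \<tau> x\<close> belongs to the tableau column of \<open>x\<close> and not to that
      of \<open>\<gamma> x = \<beta> c\<close>.\<close>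
    define c where "c = ?inv \<beta> (\<gamma> x)"
    have c: "\<beta> c = \<gamma> x" "c < d"
      using \<beta> x permutes_in_image[OF permutes_inv[OF \<beta>], of "\<gamma> x"] permutes_in_image[OF \<gamma>, of x]
      by (simp_all add: c_def permutes_inverses)
    have "col (\<tau> ((?inv \<tau> \<circ> ?inv \<gamma> \<circ> \<beta>) c)) \<noteq> col (\<beta> c)"
      using x c \<tau> \<gamma> by (simp add: permutes_inverses)
    then have "M N ((?inv \<tau> \<circ> ?inv \<gamma> \<circ> \<beta>) c) r c = 0" for r by (simp add: M_def)
    then have "det (mat d d (\<lambda>(r,c). M N ((?inv \<tau> \<circ> ?inv \<gamma> \<circ> \<beta>) c) r c)) = 0"
      unfolding det_mat_columns using c(2) by (intro sum.neutral ballI) (auto intro!: prod_zero)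
    then show ?thesis using False by simp
  qed
  have inv3: "?inv (a \<circ> b \<circ> c) = ?inv c \<circ> ?inv b \<circ> ?inv a"
    if "a permutes {..<d}" "b permutes {..<d}" "c permutes {..<d}" for a b c
    using that[THEN permutes_bij] by (simp add: o_inv_distrib bij_comp comp_assoc)
  have alt: "(\<Sum>\<gamma>\<in>column_group pss. of_int (sign \<gamma>) * bracket n K e N (\<rho> \<circ> \<gamma> \<circ> \<tau>)) =
      (\<Sum>S\<in>Pow {..<d}. (of_int (sign \<beta> * sign \<tau>) * (-1) ^ card ({..<d} - S)) * det (datum_mat as bs (P S) N))"
    if N: "N \<in> carrier_mat n n" for N
  proof -
    have "(\<Sum>S\<in>Pow {..<d}. (-1) ^ card ({..<d} - S) * det (datum_mat as bs (P S) N))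
        = (\<Sum>S\<in>Pow {..<d}. (-1) ^ card ({..<d} - S) * det (mat d d (\<lambda>(r,c). \<Sum>p\<in>S. M N p r c)))"
      by (intro sum.cong refl) (simp add: dm[OF N])
    also have "\<dots> = (\<Sum>\<pi> | \<pi> permutes {..<d}. det (mat d d (\<lambda>(r,c). M N (\<pi> c) r c)))"
      by (rule mixed_discriminant)
    also have "\<dots> = (\<Sum>\<gamma> | \<gamma> permutes {..<d}. det (mat d d (\<lambda>(r,c). M N ((?inv \<tau> \<circ> ?inv \<gamma> \<circ> \<beta>) c) r c)))"
    proof (rule sum.reindex_bij_witness[of _ "\<lambda>\<gamma>. ?inv \<tau> \<circ> ?inv \<gamma> \<circ> \<beta>" "\<lambda>\<pi>. \<beta> \<circ> ?inv \<pi> \<circ> ?inv \<tau>"], goal_cases)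
      case (1 \<pi>)
      then have \<pi>: "\<pi> permutes {..<d}" by simp
      have "?inv (\<beta> \<circ> ?inv \<pi> \<circ> ?inv \<tau>) = \<tau> \<circ> \<pi> \<circ> ?inv \<beta>"
        using inv3[OF \<beta> permutes_inv[OF \<pi>] permutes_inv[OF \<tau>]] \<pi> \<tau> by (simp add: permutes_inv_inv)
      then show ?case using \<tau> \<beta> by (simp add: fun_eq_iff permutes_inverses)
    next
      case (2 \<pi>)
      then show ?case using \<beta> \<tau> by (auto intro!: permutes_compose permutes_inv)
    next
      case (3 \<gamma>)
      then have \<gamma>: "\<gamma> permutes {..<d}" by simp
      have "?inv (?inv \<tau> \<circ> ?inv \<gamma> \<circ> \<beta>) = ?inv \<beta> \<circ> \<gamma> \<circ> \<tau>"
        using inv3[OF permutes_inv[OF \<tau>] permutes_inv[OF \<gamma>] \<beta>] \<gamma> \<tau> by (simp add: permutes_inv_inv)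
      then show ?case using \<tau> \<beta> by (simp add: fun_eq_iff permutes_inverses)
    next
      case (4 \<gamma>)
      then show ?case using \<beta> \<tau> by (auto intro!: permutes_compose permutes_inv)
    next
      case (5 \<pi>)
      then have \<pi>: "\<pi> permutes {..<d}" by simp
      have "?inv (\<beta> \<circ> ?inv \<pi> \<circ> ?inv \<tau>) = \<tau> \<circ> \<pi> \<circ> ?inv \<beta>"
        using inv3[OF \<beta> permutes_inv[OF \<pi>] permutes_inv[OF \<tau>]] \<pi> \<tau> by (simp add: permutes_inv_inv)
      then have "?inv \<tau> \<circ> ?inv (\<beta> \<circ> ?inv \<pi> \<circ> ?inv \<tau>) \<circ> \<beta> = \<pi>"
        using \<tau> \<beta> by (simp add: fun_eq_iff permutes_inverses)
      then show ?case by simp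
    qed
    also have "\<dots> = (\<Sum>\<gamma> | \<gamma> permutes {..<d}. if \<gamma> \<in> column_group pss then of_int (sign \<beta> * sign \<tau>) *
         (of_int (sign \<gamma>) * bracket n K e N (\<rho> \<circ> \<gamma> \<circ> \<tau>)) else 0)"
      by (intro sum.cong refl term_eq) simp
    also have "\<dots> = of_int (sign \<beta> * sign \<tau>) *
        (\<Sum>\<gamma>\<in>column_group pss. of_int (sign \<gamma>) * bracket n K e N (\<rho> \<circ> \<gamma> \<circ> \<tau>))"
      unfolding sum_distrib_left
      by (rule sum.mono_neutral_cong_right) (auto simp: finite_permutations cg)
    finally have *: "(\<Sum>S\<in>Pow {..<d}. (-1) ^ card ({..<d} - S) * det (datum_mat as bs (P S) N)) = \<dots>" .
    \<comment> \<open>The sign factor is its own inverse, so it can be moved to the other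
      side.\<close>
    have "(of_int (sign \<beta> * sign \<tau>) :: complex) * of_int (sign \<beta> * sign \<tau>) = 1"
      by (simp add: sign_def)
    with arg_cong[OF *, of "\<lambda>x. of_int (sign \<beta> * sign \<tau>) * x"] show ?thesis
      by (simp only: sum_distrib_left[symmetric] mult.assoc[symmetric] mult_1_left)
         (simp only: sum_distrib_left mult.assoc)
  qed
  have app: "(\<Sum>S\<in>A. F S) N = (\<Sum>S\<in>A. F S N)"
    for A :: "nat set set" and F :: "_ \<Rightarrow> complex mat \<Rightarrow> complex" and N
    by (induction A rule: infinite_finite_induct) simp_all
  have "(\<lambda>N. if N \<in> nilpotent_cone n
      then \<Sum>\<gamma>\<in>column_group pss. of_int (sign \<gamma>) * bracket n K e N (\<rho> \<circ> \<gamma> \<circ> \<tau>) else 0)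
    = (\<Sum>S\<in>Pow {..<d}. (\<lambda>N. (of_int (sign \<beta> * sign \<tau>) * (-1) ^ card ({..<d} - S)) * datum_fun n as bs (P S) N))"
    by (rule ext) (auto simp: app alt datum_fun_def nilpotent_cone_def)
  also have "\<dots> \<in> fun_space.span {datum_fun n as bs P | as bs P. is_datum n as bs P}"
    by (intro fun_space.span_sum fun_space.span_scale fun_space.span_base) (use dat in blast)
  finally show ?thesis .
qed

section \<open>Regularity and unipotent invariance of the datum functions\<close>

lemma polynomial_functions_sum:
  assumes "\<And>a. a \<in> S \<Longrightarrow> F a \<in> polynomial_functions n"
  shows "(\<lambda>N. \<Sum>a\<in>S. F a N) \<in> polynomial_functions n"
  using assms
  by (induction S rule: infinite_finite_induct) (auto intro: polynomial_functions.intros)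

lemma polynomial_functions_prod:
  assumes "\<And>a. a \<in> S \<Longrightarrow> F a \<in> polynomial_functions n"
  shows "(\<lambda>N. \<Prod>a\<in>S. F a N) \<in> polynomial_functions n"
  using assms
  by (induction S rule: infinite_finite_induct) (auto intro: polynomial_functions.intros)

text \<open>Agreement is required on \<open>n\<close> by \<open>n\<close> matrices only: the
  functions at hand, such as entries of \<open>N ^\<^sub>m k\<close>, depend on the dimensions of
  \<open>N\<close> and need not be polynomial functions on the whole type.\<close>

definition polynomial_on_matrices :: "nat \<Rightarrow> (complex mat \<Rightarrow> complex) \<Rightarrow> bool" where
  "polynomial_on_matrices n F \<longleftrightarrow>
     (\<exists>p\<in>polynomial_functions n. \<forall>N\<in>carrier_mat n n. F N = p N)"

lemma polynomial_on_matrices_const: "polynomial_on_matrices n (\<lambda>_. c)"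
  unfolding polynomial_on_matrices_def
  by (rule bexI[of _ "\<lambda>_. c"]) (simp_all add: polynomial_functions.const)

lemma polynomial_on_matrices_mult:
  assumes "polynomial_on_matrices n F" "polynomial_on_matrices n G"
  shows "polynomial_on_matrices n (\<lambda>N. F N * G N)"
proof -
  obtain p q where "p \<in> polynomial_functions n" "q \<in> polynomial_functions n"
    "\<forall>N\<in>carrier_mat n n. F N = p N" "\<forall>N\<in>carrier_mat n n. G N = q N"
    using assms unfolding polynomial_on_matrices_def by blast
  then show ?thesis unfolding polynomial_on_matrices_def
    by (intro bexI[of _ "\<lambda>N. p N * q N"]) (auto intro: polynomial_functions.mult)
qed

lemma polynomial_on_matrices_sum:
  assumes "\<And>a. a \<in> S \<Longrightarrow> polynomial_on_matrices n (F a)"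
  shows "polynomial_on_matrices n (\<lambda>N. \<Sum>a\<in>S. F a N)"
proof -
  obtain p where "\<And>a. a \<in> S \<Longrightarrow> p a \<in> polynomial_functions n \<and> (\<forall>N\<in>carrier_mat n n. F a N = p a N)"
    using bchoice[of S "\<lambda>a p. p \<in> polynomial_functions n \<and> (\<forall>N\<in>carrier_mat n n. F a N = p N)"] assms
    unfolding polynomial_on_matrices_def by blast
  then show ?thesis unfolding polynomial_on_matrices_def
    by (intro bexI[of _ "\<lambda>N. \<Sum>a\<in>S. p a N"]) (auto intro!: polynomial_functions_sum)
qed

lemma polynomial_on_matrices_prod:
  assumes "\<And>a. a \<in> S \<Longrightarrow> polynomial_on_matrices n (F a)"
  shows "polynomial_on_matrices n (\<lambda>N. \<Prod>a\<in>S. F a N)"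
proof -
  obtain p where "\<And>a. a \<in> S \<Longrightarrow> p a \<in> polynomial_functions n \<and> (\<forall>N\<in>carrier_mat n n. F a N = p a N)"
    using bchoice[of S "\<lambda>a p. p \<in> polynomial_functions n \<and> (\<forall>N\<in>carrier_mat n n. F a N = p N)"] assms
    unfolding polynomial_on_matrices_def by blast
  then show ?thesis unfolding polynomial_on_matrices_def
    by (intro bexI[of _ "\<lambda>N. \<Prod>a\<in>S. p a N"]) (auto intro!: polynomial_functions_prod)
qed

lemma polynomial_on_matrices_cong:
  "polynomial_on_matrices n F \<Longrightarrow> (\<And>N. N \<in> carrier_mat n n \<Longrightarrow> F N = G N) \<Longrightarrow>
    polynomial_on_matrices n G"
  unfolding polynomial_on_matrices_def by metis

lemma polynomial_on_matrices_pow_mat: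
  assumes "x < n" "y < n"
  shows "polynomial_on_matrices n (\<lambda>N. (N ^\<^sub>m k) $$ (x,y))"
  using assms
proof (induction k arbitrary: y)
  case 0
  show ?case
    by (rule polynomial_on_matrices_cong[OF polynomial_on_matrices_const[of n "1\<^sub>m n $$ (x,y)"]]) simp
next
  case (Suc k)
  have entry: "polynomial_on_matrices n (\<lambda>N. N $$ (z,y))" if "z < n" for z
    unfolding polynomial_on_matrices_def using that Suc.prems
    by (intro bexI[of _ "\<lambda>N. N $$ (z,y)"]) (simp_all add: polynomial_functions.entry)
  have "polynomial_on_matrices n (\<lambda>N. \<Sum>z<n. (N ^\<^sub>m k) $$ (x,z) * N $$ (z,y))"
    using Suc entry by (intro polynomial_on_matrices_sum polynomial_on_matrices_mult) auto
  then show ?case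
  proof (rule polynomial_on_matrices_cong)
    fix N :: "complex mat" assume N: "N \<in> carrier_mat n n"
    have "N ^\<^sub>m k \<in> carrier_mat n n" using N by simp
    then show "(\<Sum>z<n. (N ^\<^sub>m k) $$ (x,z) * N $$ (z,y)) = (N ^\<^sub>m Suc k) $$ (x,y)"
      using N Suc.prems by (auto simp: scalar_prod_def atLeast0LessThan)
  qed
qed

lemma datum_bounds:
  assumes "is_datum n as bs P"
  shows "i < length as \<Longrightarrow> as ! i \<in> {1..n}" "j < length bs \<Longrightarrow> bs ! j \<in> {1..n}"
  using assms unfolding is_datum_def by (meson nth_mem subsetD)+

lemma datum_mat_carrier:
  "is_datum n as bs P \<Longrightarrow> datum_mat as bs P N \<in> carrier_mat (sum_list as) (sum_list as)"
  by (simp add: datum_mat_def block_mat_def is_datum_def)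

lemma datum_fun_regular:
  assumes dat: "is_datum n as bs P"
  shows "datum_fun n as bs P \<in> regular_functions n"
proof -
  let ?d = "sum_list as"
  have d: "sum_list bs = ?d" using dat by (simp add: is_datum_def)
  have entry: "polynomial_on_matrices n (\<lambda>N. datum_mat as bs P N $$ (p,q))" if pq: "p < ?d" "q < ?d" for p q
  proof -
    obtain i k j l where bp: "block_pos as p = (i,k)" "block_pos bs q = (j,l)" by fastforce
    have q': "q < sum_list bs" using pq d by simp
    have "i < length as" "k < as ! i" "j < length bs" "l < bs ! j"
      using block_pos_bounds[OF pq(1) bp(1)] block_pos_bounds[OF q' bp(2)] by auto
    then have lt: "n - as ! i + k < n" "l < n" using datum_bounds(1)[OF dat, of i] datum_bounds(2)[OF dat, of j] by auto
    have "polynomial_on_matrices n (\<lambda>N. \<Sum>m\<le>degree (P i j). coeff (P i j) m * (N ^\<^sub>m m) $$ (n - as ! i + k, l))"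
      by (intro polynomial_on_matrices_sum polynomial_on_matrices_mult polynomial_on_matrices_const
          polynomial_on_matrices_pow_mat lt)
    then show ?thesis
      by (rule polynomial_on_matrices_cong)
         (use datum_mat_index[OF _ dat pq(1) q' bp] mat_poly_bound[OF _ lt order_refl] in auto)
  qed
  have "polynomial_on_matrices n (\<lambda>N. \<Sum>\<pi> | \<pi> permutes {..<?d}.
      of_int (sign \<pi>) * (\<Prod>c<?d. datum_mat as bs P N $$ (\<pi> c, c)))"
  proof (intro polynomial_on_matrices_sum polynomial_on_matrices_mult polynomial_on_matrices_const
      polynomial_on_matrices_prod entry)
    fix \<pi> c assume "\<pi> \<in> {\<pi>. \<pi> permutes {..<?d}}" "c \<in> {..<?d}"
    then show "\<pi> c < ?d" "c < ?d" using permutes_in_image[of \<pi> "{..<?d}" c] by auto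
  qed
  then have "polynomial_on_matrices n (\<lambda>N. det (datum_mat as bs P N))"
    by (rule polynomial_on_matrices_cong)
       (simp add: det_col[OF datum_mat_carrier[OF dat]] atLeast0LessThan)
  then obtain p where "p \<in> polynomial_functions n" "\<forall>N\<in>carrier_mat n n. det (datum_mat as bs P N) = p N"
    unfolding polynomial_on_matrices_def by blast
  then show ?thesis
    unfolding regular_functions_def datum_fun_def nilpotent_cone_def by auto
qed

lemma index_mult_mat_sum:
  assumes "A \<in> carrier_mat n n" "B \<in> carrier_mat n n" "x < n" "y < n"
  shows "(A * B) $$ (x,y) = (\<Sum>z<n. A $$ (x,z) * B $$ (z,y))"
  using assms by (auto simp: scalar_prod_def atLeast0LessThan)

text \<open>The intertwining relation of powers, extended linearly to polynomials. It is written
  entry by entry so that either sum can afterwards be truncated by triangularity of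
  \<open>g\<close>.\<close>

lemma mat_poly_conjugate:
  assumes g: "g \<in> carrier_mat n n" and h: "h \<in> carrier_mat n n" and N: "N \<in> carrier_mat n n"
    and hg: "h * g = 1\<^sub>m n" and xy: "x < n" "y < n"
  shows "(\<Sum>z<n. mat_poly p (g * N * h) $$ (x,z) * g $$ (z,y)) = (\<Sum>z<n. g $$ (x,z) * mat_poly p N $$ (z,y))"
proof -
  have M: "g * N * h \<in> carrier_mat n n" using g h N by auto
  have pow: "(\<Sum>z<n. ((g * N * h) ^\<^sub>m k) $$ (x,z) * g $$ (z,y)) = (\<Sum>z<n. g $$ (x,z) * (N ^\<^sub>m k) $$ (z,y))" for k
  proof -
    have "(\<Sum>z<n. ((g * N * h) ^\<^sub>m k) $$ (x,z) * g $$ (z,y)) = ((g * N * h) ^\<^sub>m k * g) $$ (x,y)"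
      by (rule index_mult_mat_sum[OF pow_carrier_mat[OF M] g xy, symmetric])
    also have "\<dots> = (g * N ^\<^sub>m k) $$ (x,y)" unfolding pow_mat_conjugate[OF g h N hg] ..
    also have "\<dots> = (\<Sum>z<n. g $$ (x,z) * (N ^\<^sub>m k) $$ (z,y))"
      by (rule index_mult_mat_sum[OF g pow_carrier_mat[OF N] xy])
    finally show ?thesis .
  qed
  have "(\<Sum>z<n. mat_poly p (g * N * h) $$ (x,z) * g $$ (z,y))
      = (\<Sum>z<n. \<Sum>k\<le>degree p. coeff p k * (((g * N * h) ^\<^sub>m k) $$ (x,z) * g $$ (z,y)))"
    by (rule sum.cong) (use mat_poly_bound[OF M xy(1) _ order_refl, of _ p] in
        \<open>simp_all add: sum_distrib_right mult.assoc\<close>)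
  also have "\<dots> = (\<Sum>k\<le>degree p. coeff p k * (\<Sum>z<n. ((g * N * h) ^\<^sub>m k) $$ (x,z) * g $$ (z,y)))"
    unfolding sum_distrib_left by (rule sum.swap)
  also have "\<dots> = (\<Sum>k\<le>degree p. coeff p k * (\<Sum>z<n. g $$ (x,z) * (N ^\<^sub>m k) $$ (z,y)))"
    unfolding pow ..
  also have "\<dots> = (\<Sum>z<n. \<Sum>k\<le>degree p. g $$ (x,z) * (coeff p k * (N ^\<^sub>m k) $$ (z,y)))"
    unfolding sum_distrib_left by (subst sum.swap) (simp add: mult.left_commute)
  also have "\<dots> = (\<Sum>z<n. g $$ (x,z) * mat_poly p N $$ (z,y))"
    by (rule sum.cong) (use mat_poly_bound[OF N _ xy(2) order_refl, of _ p] in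
        \<open>simp_all add: sum_distrib_left\<close>)
  finally show ?thesis .
qed

text \<open>For upper triangular \<open>g\<close>, the last rows of a product \<open>g * M\<close>
  involve only the last rows of \<open>M\<close>, and the first columns of \<open>M * g\<close> only
  the first columns of \<open>M\<close>. Thus corners satisfy the intertwining relation with corners
  of \<open>g\<close>, and the datum matrices with block diagonal matrices of determinant
  \<open>1\<close>.\<close>

lemma det_datum_mat_conjugate:
  assumes dat: "is_datum n as bs P" and g: "g \<in> unipotent_group n"
    and h: "h \<in> carrier_mat n n" and hg: "h * g = 1\<^sub>m n" and N: "N \<in> carrier_mat n n"
  shows "det (datum_mat as bs P (g * N * h)) = det (datum_mat as bs P N)"
proof -
  let ?d = "sum_list as" and ?D = "datum_mat as bs P"
  have gc: "g \<in> carrier_mat n n" using g by (simp add: unipotent_group_def)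
  have ut: "g $$ (x,y) = 0" if "y < x" "x < n" for x y
    using g gc that by (auto simp: unipotent_group_def upper_triangular_def)
  have M: "g * N * h \<in> carrier_mat n n" using gc h N by auto
  have d: "sum_list bs = ?d" using dat by (simp add: is_datum_def)
  \<comment> \<open>\<open>G\<close> collects the lower right corners of \<open>g\<close>, matching
    the last rows of each block; \<open>H\<close> below collects the upper left ones, matching the
    first columns.\<close>
  define G where "G = mat ?d ?d (\<lambda>(p,q). case (block_pos as p, block_pos as q) of
     ((i,k), (j,l)) \<Rightarrow> if i = j then g $$ (n - as ! i + k, n - as ! i + l) else 0)"
  define H where "H = mat ?d ?d (\<lambda>(p,q). case (block_pos bs p, block_pos bs q) of
     ((i,k), (j,l)) \<Rightarrow> if i = j then g $$ (0 + k, 0 + l) else 0)"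
  have G: "G \<in> carrier_mat ?d ?d" "det G = 1"
    unfolding G_def using datum_bounds(1)[OF dat]
    by (simp, intro det_block_unipotent[OF g]) auto
  have H: "H \<in> carrier_mat ?d ?d" "det H = 1"
    using det_block_unipotent[OF g, of bs "\<lambda>_. 0"] datum_bounds(2)[OF dat] unfolding H_def d by auto
  have D: "?D M \<in> carrier_mat ?d ?d" for M by (rule datum_mat_carrier[OF dat])
  have "?D (g * N * h) * H = G * ?D N"
  proof (rule eq_matI)
    fix p q assume "p < dim_row (G * ?D N)" "q < dim_col (G * ?D N)"
    then have pq: "p < ?d" "q < ?d" using G D[of N] by auto
    then have q': "q < sum_list bs" using d by simp
    obtain i k j l where bp: "block_pos as p = (i,k)" "block_pos bs q = (j,l)" by fastforce
    have ij: "i < length as" "k < as ! i" "j < length bs" "l < bs ! j"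
      using block_pos_bounds[OF pq(1) bp(1)] block_pos_bounds[OF q' bp(2)] by auto
    have ab: "as ! i \<le> n" "bs ! j \<le> n" using datum_bounds(1)[OF dat, of i] datum_bounds(2)[OF dat, of j] ij by auto
    let ?x = "n - as ! i + k"
    have x: "?x < n" "l < n" using ij ab by auto
    have "(?D (g * N * h) * H) $$ (p,q) = (\<Sum>q'<?d. ?D (g * N * h) $$ (p,q') * H $$ (q',q))"
      by (rule index_mult_mat_sum[OF D H(1) pq])
    also have "\<dots> = (\<Sum>q'<sum_list bs. case block_pos bs q' of (j',l') \<Rightarrow>
        if j' = j then mat_poly (P i j) (g * N * h) $$ (?x,l') * g $$ (l',l) else 0)"
      unfolding d
    proof (rule sum.cong[OF refl])
      fix q' assume "q' \<in> {..<?d}"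
      then have q'': "q' < sum_list bs" "q' < ?d" using d by auto
      obtain j' l' where bq: "block_pos bs q' = (j',l')" by fastforce
      show "?D (g * N * h) $$ (p,q') * H $$ (q',q) = (case block_pos bs q' of (j',l') \<Rightarrow>
        if j' = j then mat_poly (P i j) (g * N * h) $$ (?x,l') * g $$ (l',l) else 0)"
        using datum_mat_index[OF M dat pq(1) q''(1) bp(1) bq] bq bp(2) pq(2) q''(2)
        by (simp add: H_def)
    qed
    also have "\<dots> = (\<Sum>j'<length bs. if j' = j then
        (\<Sum>l'<bs ! j. mat_poly (P i j) (g * N * h) $$ (?x,l') * g $$ (l',l)) else 0)"
      unfolding sum_block_pos by (intro sum.cong refl) auto
    also have "\<dots> = (\<Sum>l'<bs ! j. mat_poly (P i j) (g * N * h) $$ (?x,l') * g $$ (l',l))"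
      using ij(3) by simp
    \<comment> \<open>The added terms have \<open>l' \<ge> bs ! j > l\<close>, where
      \<open>g\<close> vanishes.\<close>
    also have "\<dots> = (\<Sum>l'<n. mat_poly (P i j) (g * N * h) $$ (?x,l') * g $$ (l',l))"
      by (rule sum.mono_neutral_left) (use ab ij ut in auto)
    also have "\<dots> = (\<Sum>z<n. g $$ (?x,z) * mat_poly (P i j) N $$ (z,l))"
      by (rule mat_poly_conjugate[OF gc h N hg x])
    \<comment> \<open>Since \<open>?x \<ge> n - as ! i\<close>, the dropped terms lie below the
      diagonal of \<open>g\<close>.\<close>
    also have "\<dots> = (\<Sum>z\<in>{n - as ! i..<n}. g $$ (?x,z) * mat_poly (P i j) N $$ (z,l))"
      by (rule sum.mono_neutral_right) (use x ut in auto)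
    also have "\<dots> = (\<Sum>k'<as ! i. g $$ (?x,n - as ! i + k') * mat_poly (P i j) N $$ (n - as ! i + k',l))"
      by (rule sum.reindex_bij_witness[of _ "\<lambda>k'. n - as ! i + k'" "\<lambda>z. z - (n - as ! i)"]) (use ab in auto)
    also have "\<dots> = (\<Sum>i'<length as. if i' = i then
        (\<Sum>k'<as ! i. g $$ (?x,n - as ! i + k') * mat_poly (P i j) N $$ (n - as ! i + k',l)) else 0)"
      using ij(1) by simp
    also have "\<dots> = (\<Sum>p'<?d. case block_pos as p' of (i',k') \<Rightarrow>
        if i' = i then g $$ (?x,n - as ! i + k') * mat_poly (P i j) N $$ (n - as ! i + k',l) else 0)"
      unfolding sum_block_pos by (intro sum.cong refl) auto
    also have "\<dots> = (\<Sum>p'<?d. G $$ (p,p') * ?D N $$ (p',q))"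
    proof (rule sum.cong[OF refl])
      fix p' assume "p' \<in> {..<?d}"
      then have p': "p' < ?d" by simp
      obtain i' k' where bq: "block_pos as p' = (i',k')" by fastforce
      show "(case block_pos as p' of (i',k') \<Rightarrow>
        if i' = i then g $$ (?x,n - as ! i + k') * mat_poly (P i j) N $$ (n - as ! i + k',l) else 0)
        = G $$ (p,p') * ?D N $$ (p',q)"
        using datum_mat_index[OF N dat p' q' bq bp(2)] bq bp(1) pq(1) p'
        by (simp add: G_def)
    qed
    also have "\<dots> = (G * ?D N) $$ (p,q)"
      by (rule index_mult_mat_sum[OF G(1) D pq, symmetric])
    finally show "(?D (g * N * h) * H) $$ (p,q) = (G * ?D N) $$ (p,q)" .
  qed (use D[of N] D[of "g * N * h"] G H in auto)
  then have "det (?D (g * N * h)) * det H = det G * det (?D N)"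
    using det_mult[OF D[of "g * N * h"] H(1)] det_mult[OF G(1) D[of N]] by simp
  then show ?thesis using G H by simp
qed

lemma datum_fun_U_invariant:
  assumes dat: "is_datum n as bs P"
  shows "datum_fun n as bs P \<in> U_invariants n"
proof -
  have "datum_fun n as bs P (g * N * h) = datum_fun n as bs P N"
    if g: "g \<in> unipotent_group n" and h: "h \<in> carrier_mat n n"
      and inv: "inverts_mat g h" "inverts_mat h g" and N: "N \<in> nilpotent_cone n" for g h N
  proof -
    have gc: "g \<in> carrier_mat n n" using g by (simp add: unipotent_group_def)
    then have gh: "g * h = 1\<^sub>m n" "h * g = 1\<^sub>m n" using inv h by (auto simp: inverts_mat_def)
    have "N \<in> carrier_mat n n" using N by (simp add: nilpotent_cone_def)
    then show ?thesis
      using det_datum_mat_conjugate[OF dat g h gh(2)] nilpotent_cone_conjugate[OF gc h gh N] N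
      by (simp add: datum_fun_def)
  qed
  then show ?thesis using datum_fun_regular[OF dat] by (auto simp: U_invariants_def)
qed

section \<open>Equality of the span and the ring of invariants\<close>

lemma U_invariants_subspace: "fun_space.subspace (U_invariants n)"
proof -
  let ?X = "nilpotent_cone n"
  have reg: "(\<lambda>_. 0) \<in> regular_functions n"
    unfolding regular_functions_def by (auto intro: polynomial_functions.const)
  have add: "(\<lambda>N. f N + g N) \<in> regular_functions n"
    if "f \<in> regular_functions n" "g \<in> regular_functions n" for f g
  proof -
    obtain p q where "p \<in> polynomial_functions n" "q \<in> polynomial_functions n"
      "\<forall>N\<in>?X. f N = p N" "\<forall>N\<in>?X. g N = q N"
      using \<open>f \<in> _\<close> \<open>g \<in> _\<close> unfolding regular_functions_def by blast
    then have "\<exists>r\<in>polynomial_functions n. \<forall>N\<in>?X. f N + g N = r N"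
      by (intro bexI[of _ "\<lambda>N. p N + q N"]) (auto intro: polynomial_functions.add)
    then show ?thesis using that unfolding regular_functions_def by simp
  qed
  have scale: "(\<lambda>N. c * f N) \<in> regular_functions n" if f: "f \<in> regular_functions n" for c f
  proof -
    obtain p where "p \<in> polynomial_functions n" "\<forall>N\<in>?X. f N = p N"
      using f unfolding regular_functions_def by blast
    then have "\<exists>r\<in>polynomial_functions n. \<forall>N\<in>?X. c * f N = r N"
      by (intro bexI[of _ "\<lambda>N. c * p N"])
         (auto intro: polynomial_functions.mult polynomial_functions.const)
    then show ?thesis using f unfolding regular_functions_def by simp
  qed
  show ?thesis
  proof (rule fun_space.subspaceI)
    show "0 \<in> U_invariants n" using reg by (simp add: U_invariants_def zero_fun_def)
    show "f + g \<in> U_invariants n" if "f \<in> U_invariants n" "g \<in> U_invariants n" for f g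
      using that add by (auto simp: U_invariants_def plus_fun_def)
    show "(\<lambda>N. c * f N) \<in> U_invariants n" if "f \<in> U_invariants n" for c f
      using that scale by (auto simp: U_invariants_def)
  qed
qed

text \<open>Evaluation of the form at the identity writes \<open>f\<close> as a multiple of the sum
  of the diagonal symmetrized coefficients. Each of these is expressed by alternated brackets
  through one tableau that serves all \<open>N\<close>, so the coefficients in the combination do
  not depend on \<open>N\<close>.\<close>

lemma U_invariant_in_span:
  assumes n: "n > 0" and f: "f \<in> U_invariants n"
  shows "f \<in> fun_space.span {datum_fun n as bs P | as bs P. is_datum n as bs P}"
    (is "f \<in> ?V")
proof -
  let ?X = "nilpotent_cone n"
  obtain K T c and w :: "(complex mat \<Rightarrow> complex) \<Rightarrow> nat \<Rightarrow> factor" where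
    K: "K > 0" and T: "finite T"
    and inv: "\<And>N i j z g. i < j \<Longrightarrow> j < n \<Longrightarrow>
      tensor_form (K * n) n (bracket_tensor n K T c w N) (elementary_action i j z g) =
      tensor_form (K * n) n (bracket_tensor n K T c w N) g"
    and val: "\<And>N. N \<in> ?X \<Longrightarrow>
      tensor_form (K * n) n (bracket_tensor n K T c w N) (\<lambda>x y. if x = y then 1 else 0) = f N"
    using U_invariant_bracket_tensor[OF n f] by metis
  define d where "d = K * n"
  define A where "A = bracket_tensor n K T c w"
  let ?W = "{..<d} \<rightarrow>\<^sub>E {..<n}"
  have supp: "A N I J = 0" if "N \<notin> ?X \<or> I \<notin> ?W" for N I J
    using that by (auto simp: A_def bracket_tensor_def d_def)
  have app: "(\<Sum>a\<in>S. F a) N = (\<Sum>a\<in>S. F a N)"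
    for S :: "'b set" and F :: "'b \<Rightarrow> complex mat \<Rightarrow> complex" and N
    by (induction S rule: infinite_finite_induct) simp_all
  have diag: "(\<lambda>N. symmetrize d (A N) \<rho> \<rho>) \<in> ?V" if \<rho>: "\<rho> \<in> ?W" for \<rho>
  proof -
    have hw: "highest_weight {..<d} \<rho> (\<lambda>v N. symmetrize d (A N) \<rho> v)"
      by (rule highest_weight_symmetrize[OF _ _ \<rho>]) (use inv supp in \<open>auto simp: A_def d_def\<close>)
    consider (zero) "\<And>N. symmetrize d (A N) \<rho> \<rho> = 0"
      | (cols) pss \<kappa> where "\<kappa> > 0" "[] \<notin> set pss" "distinct (concat pss)" "set (concat pss) = {..<d}"
        "\<And>ps. ps \<in> set pss \<Longrightarrow> map \<rho> ps = [0..<length ps]"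
        "\<And>N. complex_of_real \<kappa> * symmetrize d (A N) \<rho> \<rho> =
           (\<Sum>\<gamma>\<in>column_group pss. of_int (sign \<gamma>) * symmetrize d (A N) \<rho> (\<rho> \<circ> \<gamma>))"
    proof -
      \<comment> \<open>The diagonal coefficient is accessible because \<open>\<rho>\<close>, used
        as the row word, is constant along its own rows.\<close>
      have "row_const {..<d} \<rho> \<rho>" by (simp add: row_const_def)
      then show ?thesis
        using highest_weight_column_alternation[OF finite_lessThan hw] that
        by blast
    qed
    then show ?thesis
    proof cases
      case zero
      then have "(\<lambda>N. symmetrize d (A N) \<rho> \<rho>) = 0" by (simp add: fun_eq_iff)
      then show ?thesis by (simp only: fun_space.span_zero)
    next
      case cols
      define B where "B = (\<lambda>\<tau> a N. if N \<in> ?X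
        then \<Sum>\<gamma>\<in>column_group pss. of_int (sign \<gamma>) * bracket n K (word_exponents n (w a)) N (\<rho> \<circ> \<gamma> \<circ> \<tau>)
        else 0)"
      \<comment> \<open>For given \<open>\<tau>\<close>, only monomials whose letter word is
        \<open>\<rho> \<circ> \<tau>\<close> contribute; the inverse of \<open>\<kappa>\<close>
        undoes the factor from column alternation.\<close>
      define C where "C = (\<lambda>\<tau> a. inverse (complex_of_real \<kappa>) *
        (if \<rho> \<circ> \<tau> = word_letters n K (w a) then c a else 0))"
      have B: "B \<tau> a \<in> ?V" if "\<tau> permutes {..<d}" for \<tau> a
        unfolding B_def
        by (rule alternating_bracket_in_span[OF n K d_def cols(2-5) _ that]) (use \<rho> in auto)
      have "symmetrize d (A N) \<rho> \<rho> = (\<Sum>\<tau> | \<tau> permutes {..<d}. \<Sum>a\<in>T. C \<tau> a * B \<tau> a N)" for N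
      proof (cases "N \<in> ?X")
        case False
        then show ?thesis using supp by (simp add: symmetrize_def B_def)
      next
        case N: True
        have "A N (\<rho> \<circ> \<gamma> \<circ> \<tau>) (\<rho> \<circ> \<tau>) = (\<Sum>a\<in>T. c a * (if \<rho> \<circ> \<tau> = word_letters n K (w a)
            then bracket n K (word_exponents n (w a)) N (\<rho> \<circ> \<gamma> \<circ> \<tau>) else 0))"
          if "\<gamma> \<in> column_group pss" "\<tau> permutes {..<d}" for \<gamma> \<tau>
        proof -
          have "\<gamma> permutes {..<d}" using column_group_permutes[OF that(1)] cols(4) by simp
          then have "\<rho> \<circ> \<gamma> \<circ> \<tau> \<in> ?W" using \<rho> that(2) by (intro PiE_comp_permutes)
          then show ?thesis using N by (simp add: A_def bracket_tensor_def d_def)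
        qed
        then have "(\<Sum>\<gamma>\<in>column_group pss. of_int (sign \<gamma>) * symmetrize d (A N) \<rho> (\<rho> \<circ> \<gamma>)) =
          (\<Sum>\<gamma>\<in>column_group pss. \<Sum>\<tau> | \<tau> permutes {..<d}. \<Sum>a\<in>T. of_int (sign \<gamma>) *
            (c a * (if \<rho> \<circ> \<tau> = word_letters n K (w a)
              then bracket n K (word_exponents n (w a)) N (\<rho> \<circ> \<gamma> \<circ> \<tau>) else 0)))"
          unfolding symmetrize_def sum_distrib_left by (intro sum.cong refl) (simp add: sum_distrib_left)
        also have "\<dots> = (\<Sum>\<tau> | \<tau> permutes {..<d}. \<Sum>a\<in>T. \<Sum>\<gamma>\<in>column_group pss. of_int (sign \<gamma>) *
            (c a * (if \<rho> \<circ> \<tau> = word_letters n K (w a)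
              then bracket n K (word_exponents n (w a)) N (\<rho> \<circ> \<gamma> \<circ> \<tau>) else 0)))"
          by (subst sum.swap, rule sum.cong[OF refl], rule sum.swap)
        also have "\<dots> = (\<Sum>\<tau> | \<tau> permutes {..<d}. \<Sum>a\<in>T. complex_of_real \<kappa> * (C \<tau> a * B \<tau> a N))"
        proof (intro sum.cong refl)
          fix \<tau> a
          have C: "complex_of_real \<kappa> * (C \<tau> a * y) = (if \<rho> \<circ> \<tau> = word_letters n K (w a) then c a else 0) * y" for y
            using cols(1) by (simp add: C_def)
          show "(\<Sum>\<gamma>\<in>column_group pss. of_int (sign \<gamma>) * (c a * (if \<rho> \<circ> \<tau> = word_letters n K (w a)
              then bracket n K (word_exponents n (w a)) N (\<rho> \<circ> \<gamma> \<circ> \<tau>) else 0)))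
            = complex_of_real \<kappa> * (C \<tau> a * B \<tau> a N)"
            unfolding C using N by (simp add: B_def sum_distrib_left mult.left_commute)
        qed
        finally have "complex_of_real \<kappa> * symmetrize d (A N) \<rho> \<rho> =
            complex_of_real \<kappa> * (\<Sum>\<tau> | \<tau> permutes {..<d}. \<Sum>a\<in>T. C \<tau> a * B \<tau> a N)"
          unfolding cols(6) by (simp only: sum_distrib_left)
        then show ?thesis using cols(1) by simp
      qed
      then have "(\<lambda>N. symmetrize d (A N) \<rho> \<rho>) =
          (\<Sum>\<tau> | \<tau> permutes {..<d}. \<Sum>a\<in>T. (\<lambda>N. C \<tau> a * B \<tau> a N))"
        by (simp add: fun_eq_iff app)
      also have "\<dots> \<in> ?V"
        by (intro fun_space.span_sum fun_space.span_scale) (use B in auto)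
      finally show ?thesis .
    qed
  qed
  have "f = (\<lambda>N. inverse (fact d) * (\<Sum>\<rho>\<in>?W. (\<lambda>N. symmetrize d (A N) \<rho> \<rho>)) N)"
  proof
    fix N
    show "f N = inverse (fact d) * (\<Sum>\<rho>\<in>?W. (\<lambda>N. symmetrize d (A N) \<rho> \<rho>)) N"
    proof (cases "N \<in> ?X")
      case True
      then show ?thesis
        using val[OF True] sum_symmetrize_diagonal[where d = d and n = n and A = "A N"]
        by (simp add: app A_def d_def)
    next
      case False
      then show ?thesis
        using f supp by (simp add: app symmetrize_def U_invariants_def regular_functions_def)
    qed
  qed
  also have "\<dots> \<in> ?V"
    by (intro fun_space.span_scale fun_space.span_sum diag)
  finally show ?thesis .
qed

theorem corollary7p3:
  fixes n :: nat
  assumes "n \<ge> 1"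
  shows "fun_space.span {datum_fun n as bs P | as bs P. is_datum n as bs P} = U_invariants n"
proof
  show "fun_space.span {datum_fun n as bs P | as bs P. is_datum n as bs P} \<subseteq> U_invariants n"
    by (rule fun_space.span_minimal[OF _ U_invariants_subspace]) (auto intro: datum_fun_U_invariant)
  show "U_invariants n \<subseteq> fun_space.span {datum_fun n as bs P | as bs P. is_datum n as bs P}"
    using U_invariant_in_span[of n] assms by auto
qed

end
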